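(* Let $1\le p<\infty$, $M>0$, and let $\mu$ be a measure on $\mathbf{R}$ which is $p$-admissible within $(-\theta M,\theta M)$ for some $\theta>1$. Then the periodically repeated reflections of $\mu|_{[-M,M]}$ provide a globally $p$-admissible measure on $\mathbf{R}$; that is, the measure $\hat\mu$ on $\mathbf{R}$ defined by $$\hat\mu(A)=\sum_{k\in\mathbf{Z}}\mu\bigl(\varphi_k(A\cap[(2k-1)M,(2k+1)M))\bigr),\qquad \varphi_k(x)=(-1)^k(x-2kM),$$ is globally $p$-admissible on $\mathbf{R}$.
   Context: A measure on $\mathbf{R}$ means a positive complete Borel measure $\mu$ with $0<\mu(B)<\infty$ for every ball $B$. Balls $B=B(x,r)$ in $\mathbf{R}$ are the bounded open intervals $(x-r,x+r)$, with radius $r_B=r$, and $\lambda B=B(x,\lambda r)$. Write $u_B=\frac{1}{\mu(B)}\int_B u\,d\mu$. Upper gradient: a Borel function $g\ge 0$ on a metric space $Y$ is an upper gradient of $u:Y\to[-\infty,\infty]$ if $|u(\gamma(0))-u(\gamma(l_\gamma))|\le\int_\gamma g\,ds$ for every nonconstant compact rectifiable curve $\gamma:[0,l_\gamma]\to Y$ parameterized by arc length (the left-hand side is interpreted as $\infty$ if at least one of the two terms is $\pm\infty$). Let $B_0$ be a ball in $\mathbf{R}$. - $\mu$ is doubling within $B_0$ if there is $C>0$ such that $\mu(2B)\le C\mu(B)$ for all balls $B\subset B_0$. - The $p$-Poincaré inequality holds within $B_0$ if there are $C>0$ and $\lambda\ge1$ such that for all balls $B\subset B_0$, all integrable functions $u$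 on $\lambda B$ and all upper gradients $g$ of $u$ on $\lambda B$, $$\frac{1}{\mu(B)}\int_B|u-u_B|\,d\mu\le C r_B\Bigl(\frac{1}{\mu(\lambda B)}\int_{\lambda B}g^p\,d\mu\Bigr)^{1/p}.$$ - $\mu$ is $p$-admissible within $B_0$ if it is doubling and supports a $p$-Poincaré inequality within $B_0$. $\mu$ is globally $p$-admissible if it is $p$-admissible within every ball $B_0\subset\mathbf{R}$ with constants $C$ and $\lambda$ independent of $B_0$. *)

theory Defs
  imports "HOL-Analysis.Analysis" "HOL-Library.Nat_Bijection"
begin

section \<open>Measures on the real line\<close>

text \<open>
  A complete Borel measure is the completion of a measure on the Borel sigma-algebra.
\<close>

definition measure_on_R :: "real measure \<Rightarrow> bool" where
  "measure_on_R \<mu> \<longleftrightarrow>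
     (\<exists>\<nu>. sets \<nu> = sets borel \<and> \<mu> = completion \<nu>) \<and>
     (\<forall>x r. r > 0 \<longrightarrow> 0 < emeasure \<mu> (ball x r) \<and> emeasure \<mu> (ball x r) < \<infinity>)"


section \<open>Upper gradients\<close>

definition curve_length :: "(real \<Rightarrow> 'a::metric_space) \<Rightarrow> real \<Rightarrow> real \<Rightarrow> ennreal" where
  "curve_length \<gamma> a b =
     (SUP (n, t) \<in> {(n :: nat, t :: nat \<Rightarrow> real).
                     t 0 = a \<and> t n = b \<and> (\<forall>i<n. t i \<le> t (Suc i))}.
        \<Sum>i<n. ennreal (dist (\<gamma> (t i)) (\<gamma> (t (Suc i)))))"

text \<open>
  A nonconstant compact rectifiable curve in \<open>Y\<close> of length \<open>l\<close>, parameterized by arc length;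
  the condition \<open>l > 0\<close> says that the curve is not constant.
\<close>

definition arc_length_curve :: "'a::metric_space set \<Rightarrow> real \<Rightarrow> (real \<Rightarrow> 'a) \<Rightarrow> bool" where
  "arc_length_curve Y l \<gamma> \<longleftrightarrow>
     l > 0 \<and> continuous_on {0..l} \<gamma> \<and> \<gamma> ` {0..l} \<subseteq> Y \<and>
     (\<forall>t\<in>{0..l}. curve_length \<gamma> 0 t = ennreal t)"

definition abs_diff :: "ereal \<Rightarrow> ereal \<Rightarrow> ennreal" where
  "abs_diff a b = (if \<bar>a\<bar> = \<infinity> \<or> \<bar>b\<bar> = \<infinity> then \<infinity> else e2ennreal \<bar>a - b\<bar>)"

text \<open>
  Functions on \<open>Y\<close> are represented by total functions, of which only the values on \<open>Y\<close> matter.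
  Upper gradients may take the value \<open>\<infinity>\<close>.
\<close>

definition upper_gradient_on ::
  "'a::metric_space set \<Rightarrow> ('a \<Rightarrow> ereal) \<Rightarrow> ('a \<Rightarrow> ennreal) \<Rightarrow> bool" where
  "upper_gradient_on Y u g \<longleftrightarrow>
     g \<in> borel_measurable (restrict_space borel Y) \<and>
     (\<forall>l \<gamma>. arc_length_curve Y l \<gamma> \<longrightarrow>
        abs_diff (u (\<gamma> 0)) (u (\<gamma> l)) \<le> (\<integral>\<^sup>+t\<in>{0..l}. g (\<gamma> t) \<partial>lborel))"


section \<open>Doubling measures, Poincare inequalities, admissibility\<close>

text \<open>
  In all definitions below \<open>B\<^sub>0\<close> is a ball, and a ball \<open>B = ball x r\<close> is given by its centre and
  its radius \<open>r > 0\<close>, so that \<open>\<Lambda>B = ball x (\<Lambda> * r)\<close>. Only \<open>B\<close>, not \<open>\<Lambda>B\<close>, is required to lie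
  in \<open>B\<^sub>0\<close>.
\<close>

definition doubling_within_with :: "real \<Rightarrow> real measure \<Rightarrow> real set \<Rightarrow> bool" where
  "doubling_within_with C \<mu> B\<^sub>0 \<longleftrightarrow>
     (\<forall>x r. r > 0 \<longrightarrow> ball x r \<subseteq> B\<^sub>0 \<longrightarrow>
        emeasure \<mu> (ball x (2 * r)) \<le> ennreal C * emeasure \<mu> (ball x r))"

definition doubling_within :: "real measure \<Rightarrow> real set \<Rightarrow> bool" where
  "doubling_within \<mu> B\<^sub>0 \<longleftrightarrow> (\<exists>C>0. doubling_within_with C \<mu> B\<^sub>0)"

definition integrable_ereal_on :: "real measure \<Rightarrow> real set \<Rightarrow> (real \<Rightarrow> ereal) \<Rightarrow> bool" where
  "integrable_ereal_on \<mu> Y u \<longleftrightarrow>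
     u \<in> borel_measurable (restrict_space \<mu> Y) \<and> (\<integral>\<^sup>+x\<in>Y. e2ennreal \<bar>u x\<bar> \<partial>\<mu>) < \<infinity>"

text \<open>
  The mean value \<open>u\<^sub>B\<close>. An integrable \<open>u\<close> is finite almost everywhere, so replacing its infinite
  values by \<open>0\<close> (the effect of \<^const>\<open>real_of_ereal\<close>) does not change the integral.
\<close>

definition mean_value :: "real measure \<Rightarrow> real set \<Rightarrow> (real \<Rightarrow> ereal) \<Rightarrow> real" where
  "mean_value \<mu> B u = (LINT x:B|\<mu>. real_of_ereal (u x)) / measure \<mu> B"

definition ennreal_powr :: "ennreal \<Rightarrow> real \<Rightarrow> ennreal" where
  "ennreal_powr x a = (if x = \<infinity> then \<infinity> else ennreal (enn2real x powr a))" \<comment> \<open>for \<open>a > 0\<close>\<close>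

definition poincare_within_with ::
  "real \<Rightarrow> real \<Rightarrow> real \<Rightarrow> real measure \<Rightarrow> real set \<Rightarrow> bool" where
  "poincare_within_with p C \<Lambda> \<mu> B\<^sub>0 \<longleftrightarrow>
     (\<forall>x r u g. r > 0 \<longrightarrow> ball x r \<subseteq> B\<^sub>0 \<longrightarrow>
        integrable_ereal_on \<mu> (ball x (\<Lambda> * r)) u \<longrightarrow>
        upper_gradient_on (ball x (\<Lambda> * r)) u g \<longrightarrow>
        (\<integral>\<^sup>+y\<in>ball x r. e2ennreal \<bar>u y - ereal (mean_value \<mu> (ball x r) u)\<bar> \<partial>\<mu>)
            / emeasure \<mu> (ball x r)
          \<le> ennreal (C * r) *
             ennreal_powr ((\<integral>\<^sup>+y\<in>ball x (\<Lambda> * r). ennreal_powr (g y) p \<partial>\<mu>)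
                             / emeasure \<mu> (ball x (\<Lambda> * r))) (1 / p))"

definition poincare_within :: "real \<Rightarrow> real measure \<Rightarrow> real set \<Rightarrow> bool" where
  "poincare_within p \<mu> B\<^sub>0 \<longleftrightarrow> (\<exists>C>0. \<exists>\<Lambda>\<ge>1. poincare_within_with p C \<Lambda> \<mu> B\<^sub>0)"

definition admissible_within :: "real \<Rightarrow> real measure \<Rightarrow> real set \<Rightarrow> bool" where
  "admissible_within p \<mu> B\<^sub>0 \<longleftrightarrow> doubling_within \<mu> B\<^sub>0 \<and> poincare_within p \<mu> B\<^sub>0"

definition globally_admissible :: "real \<Rightarrow> real measure \<Rightarrow> bool" where
  "globally_admissible p \<mu> \<longleftrightarrow>
     (\<exists>C\<^sub>d>0. \<exists>C>0. \<exists>\<Lambda>\<ge>1. \<forall>x\<^sub>0 r\<^sub>0. r\<^sub>0 > 0 \<longrightarrow>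
        doubling_within_with C\<^sub>d \<mu> (ball x\<^sub>0 r\<^sub>0) \<and> poincare_within_with p C \<Lambda> \<mu> (ball x\<^sub>0 r\<^sub>0))"


section \<open>Periodically repeated reflections\<close>

definition period_cell :: "real \<Rightarrow> int \<Rightarrow> real set" where
  "period_cell M k = {(2 * of_int k - 1) * M ..< (2 * of_int k + 1) * M}"

definition fold_map :: "real \<Rightarrow> int \<Rightarrow> real \<Rightarrow> real" where
  "fold_map M k x = (-1) powi k * (x - 2 * of_int k * M)"

definition reflected_sets :: "real \<Rightarrow> real measure \<Rightarrow> real set set" where
  "reflected_sets M \<mu> = {A. \<forall>k. fold_map M k ` (A \<inter> period_cell M k) \<in> sets \<mu>}"

definition reflected_measure :: "real \<Rightarrow> real measure \<Rightarrow> real measure" where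
  "reflected_measure M \<mu> =
     measure_of UNIV (reflected_sets M \<mu>)
       (\<lambda>A. \<Sum>\<^sub>\<infinity>k::int. emeasure \<mu> (fold_map M k ` (A \<inter> period_cell M k)))"

text \<open>
  The formula does define a measure on these sets, so that \<^const>\<open>measure_of\<close> does not fall back
  to the zero measure.
\<close>

lemma inj_fold_map: "inj (fold_map M k)"
  by (auto simp: inj_def fold_map_def)

lemma infsum_int_ennreal:
  fixes f :: "int \<Rightarrow> ennreal"
  shows "(\<Sum>\<^sub>\<infinity>k. f k) = (\<integral>\<^sup>+k. f k \<partial>count_space UNIV)"
proof -
  have bij: "bij_betw int_decode UNIV UNIV"
    by (rule bij_int_decode)
  have "(\<lambda>n. f (int_decode n)) summable_on UNIV"
    by (rule nonneg_summable_on_complete) simp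
  then have "((\<lambda>n. f (int_decode n)) has_sum (\<Sum>\<^sub>\<infinity>n. f (int_decode n))) UNIV"
    by (rule has_sum_infsum)
  then have "(\<lambda>n. f (int_decode n)) sums (\<Sum>\<^sub>\<infinity>n. f (int_decode n))"
    by (rule has_sum_imp_sums)
  then have "(\<Sum>n. f (int_decode n)) = (\<Sum>\<^sub>\<infinity>n. f (int_decode n))"
    by (simp add: sums_iff)
  then show ?thesis
    using infsum_reindex_bij_betw[OF bij, of f] nn_integral_bij_count_space[OF bij, of f]
    by (simp add: nn_integral_count_space_nat)
qed

lemma sigma_algebra_reflected_sets:
  assumes "measure_on_R \<mu>"
  shows "sigma_algebra UNIV (reflected_sets M \<mu>)"
proof -
  obtain \<nu> where \<nu>: "sets \<nu> = sets borel" "\<mu> = completion \<nu>"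
    using assms by (auto simp: measure_on_R_def)
  have cell: "fold_map M k ` period_cell M k \<in> sets \<mu>" for k
  proof -
    define s :: real where "s = (-1) powi k"
    have s: "s * s = 1"
      by (simp add: s_def flip: power_int_mult_distrib)
    have "fold_map M k ` period_cell M k = (\<lambda>y. s * y + 2 * of_int k * M) -` period_cell M k"
    proof (intro equalityI subsetI)
      fix y assume "y \<in> fold_map M k ` period_cell M k"
      then obtain x where x: "x \<in> period_cell M k" "y = s * (x - 2 * of_int k * M)"
        by (auto simp: fold_map_def s_def)
      have "s * y + 2 * of_int k * M = (s * s) * (x - 2 * of_int k * M) + 2 * of_int k * M"
        by (simp add: x(2))
      with x(1) s show "y \<in> (\<lambda>y. s * y + 2 * of_int k * M) -` period_cell M k"
        by simp
    next
      fix y assume y: "y \<in> (\<lambda>y. s * y + 2 * of_int k * M) -` period_cell M k"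
      have "fold_map M k (s * y + 2 * of_int k * M) = (s * s) * y"
        by (simp add: fold_map_def s_def)
      then have "y = fold_map M k (s * y + 2 * of_int k * M)"
        by (simp only: s mult_1)
      then show "y \<in> fold_map M k ` period_cell M k"
        using y by (intro image_eqI[of y]) simp_all
    qed
    moreover have "(\<lambda>y. s * y + 2 * of_int k * M) -` period_cell M k \<in> sets borel"
    proof -
      have "(\<lambda>y. s * y + 2 * of_int k * M) \<in> borel_measurable borel"
        by measurable
      from measurable_sets[OF this, of "period_cell M k"] show ?thesis
        by (simp add: period_cell_def)
    qed
    ultimately show ?thesis
      using \<nu> by auto
  qed
  have "fold_map M k ` ((UNIV - A) \<inter> period_cell M k) \<in> sets \<mu>"
    if "A \<in> reflected_sets M \<mu>" for A k
  proof -
    have "fold_map M k ` ((UNIV - A) \<inter> period_cell M k) =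
        fold_map M k ` period_cell M k - fold_map M k ` (A \<inter> period_cell M k)"
      by (subst image_set_diff[OF inj_fold_map, symmetric]) (rule arg_cong[of _ _ "image _"], blast)
    with cell that show ?thesis
      by (auto simp: reflected_sets_def)
  qed
  moreover have "fold_map M k ` ((\<Union>i::nat. A i) \<inter> period_cell M k) \<in> sets \<mu>"
    if "range A \<subseteq> reflected_sets M \<mu>" for A k
  proof -
    have "fold_map M k ` ((\<Union>i. A i) \<inter> period_cell M k) =
        (\<Union>i. fold_map M k ` (A i \<inter> period_cell M k))"
      by auto
    moreover have "\<dots> \<in> sets \<mu>"
      using that by (intro sets.countable_UN) (auto simp: reflected_sets_def)
    ultimately show ?thesis
      by simp
  qed
  ultimately show ?thesis
    unfolding sigma_algebra_iff2 by (auto simp: reflected_sets_def)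
qed

lemma sets_reflected_measure:
  assumes "measure_on_R \<mu>"
  shows "sets (reflected_measure M \<mu>) = reflected_sets M \<mu>"
proof -
  interpret sigma_algebra UNIV "reflected_sets M \<mu>"
    by (rule sigma_algebra_reflected_sets[OF assms])
  show ?thesis
    by (simp add: reflected_measure_def)
qed

lemma emeasure_reflected_measure:
  assumes "measure_on_R \<mu>" "A \<in> sets (reflected_measure M \<mu>)"
  shows "emeasure (reflected_measure M \<mu>) A =
           (\<Sum>\<^sub>\<infinity>k. emeasure \<mu> (fold_map M k ` (A \<inter> period_cell M k)))"
  unfolding reflected_measure_def
proof (rule emeasure_measure_of_sigma)
  let ?m = "\<lambda>A. \<Sum>\<^sub>\<infinity>k. emeasure \<mu> (fold_map M k ` (A \<inter> period_cell M k))"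
  show "sigma_algebra UNIV (reflected_sets M \<mu>)"
    by (rule sigma_algebra_reflected_sets[OF assms(1)])
  show "positive (reflected_sets M \<mu>) ?m"
    by (simp add: positive_def)
  show "countably_additive (reflected_sets M \<mu>) ?m"
  proof (rule countably_additiveI)
    fix A :: "nat \<Rightarrow> real set"
    assume A: "range A \<subseteq> reflected_sets M \<mu>" "disjoint_family A"
    have "(\<Sum>i. emeasure \<mu> (fold_map M k ` (A i \<inter> period_cell M k))) =
        emeasure \<mu> (fold_map M k ` ((\<Union>i. A i) \<inter> period_cell M k))" for k
    proof -
      have "disjoint_family (\<lambda>i. fold_map M k ` (A i \<inter> period_cell M k))"
        using A(2) unfolding disjoint_family_on_def
        by (simp add: image_Int[OF inj_fold_map, symmetric]) blast
      moreover have "range (\<lambda>i. fold_map M k ` (A i \<inter> period_cell M k)) \<subseteq> sets \<mu>"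
        using A(1) by (auto simp: reflected_sets_def)
      ultimately have "(\<Sum>i. emeasure \<mu> (fold_map M k ` (A i \<inter> period_cell M k))) =
          emeasure \<mu> (\<Union>i. fold_map M k ` (A i \<inter> period_cell M k))"
        by (intro suminf_emeasure)
      also have "(\<Union>i. fold_map M k ` (A i \<inter> period_cell M k)) =
          fold_map M k ` ((\<Union>i. A i) \<inter> period_cell M k)"
        by auto
      finally show ?thesis .
    qed
    then show "(\<Sum>i. ?m (A i)) = ?m (\<Union>i. A i)"
      by (simp add: infsum_int_ennreal flip: nn_integral_suminf)
  qed
  show "A \<in> reflected_sets M \<mu>"
    using assms by (simp add: sets_reflected_measure)
qed

end

theory Submission
  imports Defs
begin

text \<open>
  On the line, local \<open>p\<close>-admissibility is equivalent to doubling together with the dual form of the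
  Muckenhoupt condition, \<open>\<integral>\<^sub>B g dx \<le> K r (\<integral>\<^sub>B g\<^sup>p d\<mu> / \<mu>(B))\<^bsup>1/p\<^esup>\<close> for all Borel \<open>g \<ge> 0\<close>. It follows from the
  Poincare inequality on \<open>3B\<close>, applied to a primitive of \<open>g\<close> restricted to \<open>B\<close>: this primitive is
  constant on either side of \<open>B\<close> and jumps by \<open>\<integral>\<^sub>B g dx\<close>, and the two sides carry a fixed share of the
  mass of \<open>3B\<close>. Conversely it gives the Poincare inequality with \<open>\<Lambda> = 1\<close>, because the oscillation of
  \<open>u\<close> on \<open>B\<close> is at most \<open>\<integral>\<^sub>B g dx\<close>.

  Folding is 1-Lipschitz and a ball of radius at most \<open>M\<close> meets at most three cells, so doubling and
  the Muckenhoupt condition pass from \<open>\<mu>\<close> to the reflected measure on balls of small radius,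
  uniformly in the centre; only the values of \<open>\<mu>\<close> slightly beyond \<open>[-M, M]\<close> enter, which is where
  \<open>\<theta> > 1\<close> is needed. Balls of this fixed small radius have masses between two positive constants, so
  cutting a large ball into pieces of that size and using a power mean inequality settles large radii.
\<close>

section \<open>Powers of extended nonnegative reals\<close>

lemma ennreal_powr_mono:
  assumes "x \<le> y" "0 \<le> a"
  shows "ennreal_powr x a \<le> ennreal_powr y a"
proof (cases "y = \<infinity>")
  case False
  then show ?thesis
    using assms by (auto simp: ennreal_powr_def top_unique less_top intro!: ennreal_leI powr_mono2 enn2real_mono)
qed (simp add: ennreal_powr_def)

lemma ennreal_powr_0 [simp]: "ennreal_powr 0 a = 0"
  by (simp add: ennreal_powr_def)

lemma ennreal_powr_indicator: "ennreal_powr (x * indicator A t) a = ennreal_powr x a * indicator A t"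
  by (simp add: indicator_def)

lemma ennreal_powr_measurable [measurable (raw)]:
  assumes [measurable]: "f \<in> borel_measurable M"
  shows "(\<lambda>x. ennreal_powr (f x) a) \<in> borel_measurable M"
  unfolding ennreal_powr_def by measurable

text \<open>As c >= 1 and a <= 1, c powr a is at most c. This moves constants out of the power 1/p
  without tracking their roots.\<close>

lemma ennreal_powr_cmult_le:
  assumes "1 \<le> c" "0 < a" "a \<le> 1"
  shows "ennreal_powr (ennreal c * x) a \<le> ennreal c * ennreal_powr x a"
proof (cases "x = \<infinity>")
  case False
  then obtain y where y: "x = ennreal y" "0 \<le> y"
    by (metis ennreal_cases infinity_ennreal_def)
  have "(c * y) powr a \<le> c * y powr a"
    using assms y powr_mono[of a 1 c] by (simp add: powr_mult mult_right_mono)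
  then show ?thesis
    using assms y by (simp add: ennreal_powr_def flip: ennreal_mult)
qed (use assms in \<open>simp add: ennreal_powr_def ennreal_mult_top\<close>)

text \<open>A power mean inequality for the concave function t powr q. The factor 2 is the price for
  avoiding Jensen's inequality: after division by the mean m, the elementary bound t powr q <= 1 + t
  sums to \<open>2 * card I\<close>.\<close>

lemma sum_powr_le:
  fixes a :: "'i \<Rightarrow> real"
  assumes "finite I" "I \<noteq> {}" "\<And>i. i \<in> I \<Longrightarrow> 0 \<le> a i" "0 < q" "q \<le> 1"
  shows "(\<Sum>i\<in>I. a i powr q) \<le> 2 * card I * ((\<Sum>i\<in>I. a i) / card I) powr q"
proof -
  define m where "m = (\<Sum>i\<in>I. a i) / card I"
  have card: "card I > 0"
    using assms by (simp add: card_gt_0_iff)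
  have m0: "m \<ge> 0"
    unfolding m_def using assms by (intro divide_nonneg_nonneg sum_nonneg) auto
  show ?thesis
  proof (cases "m = 0")
    case True
    then have "(\<Sum>i\<in>I. a i) = 0"
      using card by (simp add: m_def)
    then have "\<And>i. i \<in> I \<Longrightarrow> a i = 0"
      using assms by (simp add: sum_nonneg_eq_0_iff)
    then show ?thesis
      by simp
  next
    case False
    then have m: "m > 0"
      using m0 by simp
    have powr_le: "t powr q \<le> 1 + t" if "t \<ge> 0" for t :: real
    proof (cases "t \<le> 1")
      case True
      then have "t powr q \<le> 1 powr q"
        using that assms by (intro powr_mono2) auto
      then show ?thesis
        using that by simp
    next
      case False
      then have "t powr q \<le> t powr 1"
        using assms by (intro powr_mono) auto
      then show ?thesis
        using False by simp
    qed
    have "a i powr q \<le> m powr q * (1 + a i / m)" if "i \<in> I" for i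
    proof -
      have "a i powr q = m powr q * (a i / m) powr q"
        using m assms(3)[OF that] by (simp flip: powr_mult)
      also have "\<dots> \<le> m powr q * (1 + a i / m)"
        using m assms(3)[OF that] by (intro mult_left_mono powr_le) auto
      finally show ?thesis .
    qed
    then have "(\<Sum>i\<in>I. a i powr q) \<le> (\<Sum>i\<in>I. m powr q * (1 + a i / m))"
      by (rule sum_mono)
    also have "\<dots> = m powr q * (card I + (\<Sum>i\<in>I. a i) / m)"
      by (simp add: sum.distrib sum_divide_distrib flip: sum_distrib_left)
    also have "(\<Sum>i\<in>I. a i) / m = card I"
      using m card by (simp add: m_def field_simps)
    finally show ?thesis
      by (simp add: m_def mult.commute)
  qed
qed

text \<open>Monotone convergence for truncations. It reduces integral inequalities for g to bounded
  g, whose primitives over a ball are finite.\<close>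

lemma nn_integral_SUP_min:
  fixes g :: "'a \<Rightarrow> ennreal"
  assumes [measurable]: "g \<in> borel_measurable M" "A \<in> sets M"
  shows "(\<integral>\<^sup>+x\<in>A. g x \<partial>M) = (SUP n::nat. \<integral>\<^sup>+x\<in>A. min (g x) (of_nat n) \<partial>M)"
proof -
  have *: "(SUP n::nat. min (g x) (of_nat n) * indicator A x) = g x * indicator A x" for x
  proof -
    have "(SUP n::nat. min (g x) (of_nat n)) = min (g x) (SUP n::nat. of_nat n)"
      by (simp add: inf_min[symmetric] inf_SUP)
    then have "(SUP n::nat. min (g x) (of_nat n)) = g x"
      by (simp add: ennreal_SUP_of_nat_eq_top)
    then show ?thesis
      by (simp add: indicator_def)
  qed
  have "incseq (\<lambda>n x. min (g x) (of_nat n) * indicator A x)"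
    by (auto simp: incseq_def le_fun_def intro!: mult_right_mono min.mono)
  from nn_integral_monotone_convergence_SUP[OF this, of M] show ?thesis
    unfolding * by simp
qed


section \<open>Curves and upper gradients on the line\<close>

text \<open>Appending t to a partition that ends at s gives a partition that ends at t, and its sum
  grows by the last chord.\<close>

lemma curve_length_add_dist_le:
  fixes \<gamma> :: "real \<Rightarrow> 'a::metric_space"
  assumes "a \<le> s" "s \<le> t"
  shows "curve_length \<gamma> a s + ennreal (dist (\<gamma> s) (\<gamma> t)) \<le> curve_length \<gamma> a t"
proof -
  let ?P = "\<lambda>b. {(n :: nat, t :: nat \<Rightarrow> real). t 0 = a \<and> t n = b \<and> (\<forall>i<n. t i \<le> t (Suc i))}"
  let ?f = "\<lambda>(n, t). \<Sum>i<n. ennreal (dist (\<gamma> (t i)) (\<gamma> (t (Suc i))))"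
  \<comment> \<open>The trivial partition makes the index set nonempty, so that the added constant
    can be moved into the supremum.\<close>
  have "(1, \<lambda>i. if i = 0 then a else s) \<in> ?P s"
    using assms by auto
  then have "?P s \<noteq> {}"
    by blast
  then have "curve_length \<gamma> a s + ennreal (dist (\<gamma> s) (\<gamma> t)) =
      (SUP x\<in>?P s. ?f x + ennreal (dist (\<gamma> s) (\<gamma> t)))"
    unfolding curve_length_def by (intro ennreal_SUP_add_left[symmetric]) auto
  also have "\<dots> \<le> curve_length \<gamma> a t"
  proof (rule SUP_least)
    fix x assume x: "x \<in> ?P s"
    obtain n u where xu: "x = (n, u)"
      by (cases x)
    define v where "v = u(Suc n := t)"
    have "(Suc n, v) \<in> ?P t"
      using x xu assms by (auto simp: v_def less_Suc_eq)
    moreover have "?f x + ennreal (dist (\<gamma> s) (\<gamma> t)) = ?f (Suc n, v)"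
      using x xu by (auto simp: v_def simp del: sum_ennreal intro!: sum.cong)
    ultimately show "?f x + ennreal (dist (\<gamma> s) (\<gamma> t)) \<le> curve_length \<gamma> a t"
      unfolding curve_length_def by (metis (no_types, lifting) SUP_upper)
  qed
  finally show ?thesis .
qed

text \<open>The length up to s plus the chord from s to t is at most the length up to t; for an arc
  length parameterization this reads s + dist <= t.\<close>

lemma arc_length_curve_Lipschitz:
  assumes "arc_length_curve Y l \<gamma>" "0 \<le> s" "s \<le> t" "t \<le> l"
  shows "dist (\<gamma> s) (\<gamma> t) \<le> t - s"
proof -
  have "ennreal s + ennreal (dist (\<gamma> s) (\<gamma> t)) \<le> ennreal t"
    using curve_length_add_dist_le[of 0 s t \<gamma>] assms by (simp add: arc_length_curve_def)
  then show ?thesis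
    using assms by (simp flip: ennreal_plus)
qed

text \<open>A translation is increasing, so every partition sum telescopes to the same value.
  Segments are the curves on which a given upper gradient will be tested.\<close>

lemma arc_length_curve_segment:
  fixes x y :: real
  assumes "x < y" "{x..y} \<subseteq> Y"
  shows "arc_length_curve Y (y - x) (\<lambda>t. x + t)"
proof -
  have "curve_length (\<lambda>t. x + t) 0 t = ennreal t" if "0 \<le> t" for t
  proof -
    have sum: "(\<Sum>i<n. ennreal (dist (x + u i) (x + u (Suc i)))) = ennreal t"
      if "u 0 = 0" "u n = t" "\<forall>i<n. u i \<le> u (Suc i)" for n and u :: "nat \<Rightarrow> real"
    proof -
      have "(\<Sum>i<n. ennreal (dist (x + u i) (x + u (Suc i)))) = (\<Sum>i<n. ennreal (u (Suc i) - u i))"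
        using that by (intro sum.cong) (auto simp: dist_real_def)
      also have "\<dots> = ennreal (\<Sum>i<n. u (Suc i) - u i)"
        using that by (intro sum_ennreal) auto
      finally show ?thesis
        using that by (simp add: sum_lessThan_telescope)
    qed
    show ?thesis
      unfolding curve_length_def
    proof (rule antisym)
      let ?x = "(1 :: nat, \<lambda>i :: nat. if i = 0 then 0 else t)"
      have "?x \<in> {(n, u). u 0 = 0 \<and> u n = t \<and> (\<forall>i<n. u i \<le> u (Suc i))}"
        using \<open>0 \<le> t\<close> by simp
      then show "ennreal t \<le> (SUP (n, u)\<in>{(n, u). u 0 = 0 \<and> u n = t \<and> (\<forall>i<n. u i \<le> u (Suc i))}.
          \<Sum>i<n. ennreal (dist (x + u i) (x + u (Suc i))))"
        by (rule SUP_upper2) (use \<open>0 \<le> t\<close> in \<open>simp add: dist_real_def\<close>)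
      show "(SUP (n, u)\<in>{(n, u). u 0 = 0 \<and> u n = t \<and> (\<forall>i<n. u i \<le> u (Suc i))}.
          \<Sum>i<n. ennreal (dist (x + u i) (x + u (Suc i)))) \<le> ennreal t"
        using sum by (intro SUP_least) (auto simp del: dist_add_cancel sum_ennreal)
    qed
  qed
  then show ?thesis
    using assms by (auto simp: arc_length_curve_def intro!: continuous_intros)
qed

section \<open>Lebesgue measure and 1-Lipschitz curves\<close>

text \<open>A 1-Lipschitz map does not increase Lebesgue measure, and A is the image of its preimage
  E in [0, l]. To see this, E is covered by intervals with disjoint interiors and total length at
  most that of E plus e, and each of them is mapped into an interval of the same length.\<close>

lemma emeasure_lborel_le_Lipschitz_vimage:
  fixes \<gamma> :: "real \<Rightarrow> real"
  assumes lip: "\<And>s t. \<bar>\<gamma> s - \<gamma> t\<bar> \<le> \<bar>s - t\<bar>"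
    and [measurable]: "A \<in> sets borel" and A: "A \<subseteq> \<gamma> ` {0..l}" and "0 \<le> l"
  shows "emeasure lborel A \<le> emeasure lborel (\<gamma> -` A \<inter> {0..l})"
proof -
  have "continuous_on UNIV \<gamma>"
    by (rule lipschitz_on_continuous_on[of 1]) (use lip in \<open>auto simp: lipschitz_on_def dist_real_def\<close>)
  then have [measurable]: "\<gamma> \<in> borel_measurable borel"
    by (rule borel_measurable_continuous_onI)
  define E where "E = \<gamma> -` A \<inter> {0..l}"
  have [measurable, simp]: "E \<in> sets borel"
    using measurable_sets[of \<gamma> borel borel A] by (simp add: E_def)
  have fm: "E \<in> lmeasurable"
    by (rule bounded_set_imp_lmeasurable) (auto simp: E_def intro: bounded_subset[of "{0..l}"])
  show ?thesis
  proof (rule ennreal_le_epsilon)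
    fix e :: real assume "0 < e"
    have "E \<subseteq> cbox 0 l"
      by (auto simp: E_def)
    then obtain D where D: "countable D" "\<And>K. K \<in> D \<Longrightarrow> K \<subseteq> cbox 0 l \<and> K \<noteq> {} \<and> (\<exists>c d. K = cbox c d)"
        "pairwise (\<lambda>A B. interior A \<inter> interior B = {}) D" "E \<subseteq> \<Union>D" "\<Union>D \<in> lmeasurable"
        "measure lebesgue (\<Union>D) \<le> measure lebesgue E + e"
      using measurable_outer_intervals_bounded[OF fm _ \<open>0 < e\<close>] by metis
    have K: "\<exists>z. K \<subseteq> cball z (measure lborel K / 2) \<and> emeasure lborel (interior K) = ennreal (measure lborel K)"
      if "K \<in> D" for K
    proof -
      obtain c d where "K = {c..d}" "c \<le> d"
        using D(2)[OF \<open>K \<in> D\<close>] by (auto simp: cbox_interval)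
      then show ?thesis
        by (intro exI[of _ "(c + d) / 2"]) (auto simp: dist_real_def abs_le_iff field_simps)
    qed
    then obtain z where z: "\<And>K. K \<in> D \<Longrightarrow> K \<subseteq> cball (z K) (measure lborel K / 2)"
      and intK: "\<And>K. K \<in> D \<Longrightarrow> emeasure lborel (interior K) = ennreal (measure lborel K)"
      by metis
    \<comment> \<open>\<open>\<gamma>\<close> maps an interval into one of the same length, centred at the image of its midpoint.\<close>
    define J where "J K = cball (\<gamma> (z K)) (measure lborel K / 2)" for K
    have [measurable]: "J K \<in> sets borel" for K
      by (simp add: J_def)
    have "A \<subseteq> (\<Union>K\<in>D. J K)"
    proof
      fix y assume "y \<in> A"
      then obtain t where t: "t \<in> E" "y = \<gamma> t"
        using A by (auto simp: E_def)
      then obtain K where "K \<in> D" "t \<in> K"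
        using D(4) by blast
      then show "y \<in> (\<Union>K\<in>D. J K)"
        using t z[of K] lip[of "z K" t] by (auto simp: J_def dist_real_def intro!: bexI[of _ K])
    qed
    \<comment> \<open>Countable subadditivity over the index set D, with the sum written as an
      integral against counting measure. A single K with y in \<open>J K\<close> already contributes
      1.\<close>
    then have "indicator A y \<le> (\<integral>\<^sup>+K. indicator (J K) y \<partial>count_space D)" for y :: real
    proof (cases "y \<in> A")
      case True
      then obtain K where "K \<in> D" "y \<in> J K"
        using \<open>A \<subseteq> (\<Union>K\<in>D. J K)\<close> by blast
      then have "(1 :: ennreal) = (\<integral>\<^sup>+L. indicator {K} L \<partial>count_space D)"
        by (simp add: emeasure_count_space_eq_0)
      also have "\<dots> \<le> (\<integral>\<^sup>+K. indicator (J K) y \<partial>count_space D)"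
        using \<open>y \<in> J K\<close> by (intro nn_integral_mono) (auto simp: indicator_def)
      finally show ?thesis
        by (simp add: True)
    qed simp
    then have "(\<integral>\<^sup>+y. indicator A y \<partial>lborel) \<le>
        (\<integral>\<^sup>+y. \<integral>\<^sup>+K. indicator (J K) y \<partial>count_space D \<partial>lborel)"
      by (rule nn_integral_mono)
    then have "emeasure lborel A \<le> (\<integral>\<^sup>+y. \<integral>\<^sup>+K. indicator (J K) y \<partial>count_space D \<partial>lborel)"
      by simp
    also have "\<dots> = (\<integral>\<^sup>+K. emeasure lborel (J K) \<partial>count_space D)"
      using D(1) by (subst nn_integral_count_space_nn_integral) auto
    \<comment> \<open>\<open>J K\<close> has the length of K, hence that of its interior. The
      interiors are disjoint, so their lengths add up to the measure of their union.\<close>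
    also have "\<dots> = (\<integral>\<^sup>+K. emeasure lborel (interior K) \<partial>count_space D)"
      by (intro nn_integral_cong) (simp add: J_def intK cball_eq_atLeastAtMost)
    also have "\<dots> = emeasure lborel (\<Union>K\<in>D. interior K)"
      using D(1,3) by (intro emeasure_UN_countable[symmetric])
        (auto simp: disjoint_family_on_def pairwise_def)
    also have "\<dots> = emeasure lebesgue (\<Union>K\<in>D. interior K)"
      using borel_open[OF open_UN, of D interior] by simp
    also have "\<dots> \<le> emeasure lebesgue (\<Union>D)"
      using D(5) interior_subset by (intro emeasure_mono) (auto simp: fmeasurable_def)
    also have "\<dots> = ennreal (measure lebesgue (\<Union>D))"
      using D(5) by (simp add: emeasure_eq_measure2)
    also have "\<dots> \<le> ennreal (measure lebesgue E) + ennreal e"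
      using D(6) \<open>0 < e\<close> by (simp flip: ennreal_plus add: ennreal_leI)
    also have "ennreal (measure lebesgue E) = emeasure lborel E"
      using emeasure_eq_measure2[OF fm] by simp
    finally show "emeasure lborel A \<le> emeasure lborel (\<gamma> -` A \<inter> {0..l}) + ennreal e"
      by (simp add: E_def)
  qed
qed

text \<open>The preceding estimate says that Lebesgue measure on [a, b] is dominated by the
  pushforward under \<open>\<gamma>\<close> of Lebesgue measure on [0, l]. Integrals of h are
  monotone in the measure.\<close>

lemma nn_integral_le_Lipschitz_curve:
  fixes \<gamma> :: "real \<Rightarrow> real"
  assumes lip: "\<And>s t. \<bar>\<gamma> s - \<gamma> t\<bar> \<le> \<bar>s - t\<bar>"
    and [measurable]: "h \<in> borel_measurable borel"
    and ab: "{a..b} \<subseteq> \<gamma> ` {0..l}" and "0 \<le> l"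
  shows "(\<integral>\<^sup>+x\<in>{a..b}. h x \<partial>lborel) \<le> (\<integral>\<^sup>+t\<in>{0..l}. h (\<gamma> t) \<partial>lborel)"
proof -
  have "continuous_on UNIV \<gamma>"
    by (rule lipschitz_on_continuous_on[of 1]) (use lip in \<open>auto simp: lipschitz_on_def dist_real_def\<close>)
  then have [measurable]: "\<gamma> \<in> borel_measurable borel"
    by (rule borel_measurable_continuous_onI)
  define M1 where "M1 = density lborel (indicator {a..b})"
  define M2 where "M2 = distr (density lborel (indicator {0..l})) borel \<gamma>"
  have "M1 \<le> M2"
  proof (subst le_measure)
    show "\<forall>A\<in>sets M1. emeasure M1 A \<le> emeasure M2 A"
    proof
      fix A assume "A \<in> sets M1"
      then have [measurable]: "A \<in> sets borel"
        by (simp add: M1_def)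
      have [measurable]: "\<gamma> -` A \<in> sets borel"
        using measurable_sets[of \<gamma> borel borel A] by simp
      have "emeasure M1 A = emeasure lborel (A \<inter> {a..b})"
        by (simp add: M1_def emeasure_density Int_commute flip: indicator_inter_arith)
      also have "\<dots> \<le> emeasure lborel (\<gamma> -` (A \<inter> {a..b}) \<inter> {0..l})"
        using lip ab \<open>0 \<le> l\<close> by (intro emeasure_lborel_le_Lipschitz_vimage) auto
      also have "\<dots> \<le> emeasure lborel (\<gamma> -` A \<inter> {0..l})"
        by (intro emeasure_mono) auto
      also have "\<dots> = emeasure M2 A"
        by (simp add: M2_def emeasure_distr emeasure_density Int_commute flip: indicator_inter_arith)
      finally show "emeasure M1 A \<le> emeasure M2 A" .
    qed
  qed (simp_all add: M1_def M2_def)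
  then have "(\<integral>\<^sup>+x. h x \<partial>M1) \<le> (\<integral>\<^sup>+x. h x \<partial>M2)"
    by (intro nn_integral_mono_measure) (simp_all add: M1_def M2_def)
  then show ?thesis
    by (simp add: M1_def M2_def nn_integral_density nn_integral_distr mult.commute)
qed

section \<open>Primitives and their upper gradients\<close>

text \<open>Meaningful only where the integral is finite, since \<open>enn2real\<close> sends
  infinity to 0; the lemmas below therefore assume g integrable.\<close>

definition primitive :: "(real \<Rightarrow> ennreal) \<Rightarrow> real \<Rightarrow> real" where
  "primitive g x = enn2real (\<integral>\<^sup>+t\<in>{..x}. g t \<partial>lborel)"

lemma primitive_diff:
  assumes [measurable]: "g \<in> borel_measurable borel" and fin: "(\<integral>\<^sup>+t. g t \<partial>lborel) < \<infinity>"
    and "a \<le> b"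
  shows "ennreal (primitive g b - primitive g a) = (\<integral>\<^sup>+t\<in>{a<..b}. g t \<partial>lborel)"
    and "primitive g a \<le> primitive g b"
proof -
  have fin: "(\<integral>\<^sup>+t\<in>A. g t \<partial>lborel) < top" for A
    by (rule le_less_trans[OF nn_integral_mono fin[simplified]]) (simp add: indicator_def)
  have "(\<integral>\<^sup>+t\<in>{..b}. g t \<partial>lborel) =
      (\<integral>\<^sup>+t. g t * indicator {..a} t + g t * indicator {a<..b} t \<partial>lborel)"
    using \<open>a \<le> b\<close> by (intro nn_integral_cong) (auto simp: indicator_def)
  also have "\<dots> = (\<integral>\<^sup>+t\<in>{..a}. g t \<partial>lborel) + (\<integral>\<^sup>+t\<in>{a<..b}. g t \<partial>lborel)"
    by (rule nn_integral_add) measurable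
  finally have *: "primitive g b = primitive g a + enn2real (\<integral>\<^sup>+t\<in>{a<..b}. g t \<partial>lborel)"
    using fin by (simp add: primitive_def enn2real_plus)
  then show "ennreal (primitive g b - primitive g a) = (\<integral>\<^sup>+t\<in>{a<..b}. g t \<partial>lborel)"
    using fin by simp
  show "primitive g a \<le> primitive g b"
    using * by simp
qed

text \<open>The image of a curve is connected, so it covers the interval between its endpoints, even
  if the curve turns back. As the curve is 1-Lipschitz, the integral of g over that interval is at
  most the curve integral.\<close>

lemma upper_gradient_on_primitive:
  assumes [measurable]: "g \<in> borel_measurable borel" and fin: "(\<integral>\<^sup>+t. g t \<partial>lborel) < \<infinity>"
  shows "upper_gradient_on Y (\<lambda>x. ereal (primitive g x)) g"
proof -
  have "abs_diff (ereal (primitive g (\<gamma> 0))) (ereal (primitive g (\<gamma> l)))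
      \<le> (\<integral>\<^sup>+t\<in>{0..l}. g (\<gamma> t) \<partial>lborel)"
    if \<gamma>: "arc_length_curve Y l \<gamma>" for l \<gamma>
  proof -
    \<comment> \<open>Extending the curve by its endpoint values makes it 1-Lipschitz on the whole
      line, as the comparison of integrals requires.\<close>
    define \<eta> where "\<eta> t = \<gamma> (max 0 (min l t))" for t
    have "l > 0"
      using \<gamma> by (simp add: arc_length_curve_def)
    have lip: "\<bar>\<eta> s - \<eta> t\<bar> \<le> \<bar>s - t\<bar>" for s t
    proof (induction s t rule: linorder_wlog)
      case (le s t)
      have "dist (\<eta> s) (\<eta> t) \<le> max 0 (min l t) - max 0 (min l s)"
        unfolding \<eta>_def using \<open>l > 0\<close> le by (intro arc_length_curve_Lipschitz[OF \<gamma>]) auto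
      also have "\<dots> \<le> t - s"
        using \<open>l > 0\<close> le by auto
      finally show ?case
        by (simp add: dist_real_def)
    qed (simp add: abs_minus_commute)
    define a b where "a = min (\<gamma> 0) (\<gamma> l)" and "b = max (\<gamma> 0) (\<gamma> l)"
    have \<eta>: "\<eta> t = \<gamma> t" if "t \<in> {0..l}" for t
      using that by (simp add: \<eta>_def)
    have "connected (\<gamma> ` {0..l})"
      using \<gamma> by (intro connected_continuous_image) (auto simp: arc_length_curve_def)
    then have "{a..b} \<subseteq> \<gamma> ` {0..l}"
      using \<open>l > 0\<close> by (intro connected_contains_Icc) (auto simp: a_def b_def min_def max_def)
    also have "\<gamma> ` {0..l} = \<eta> ` {0..l}"
      using \<eta> by force
    finally have ab: "{a..b} \<subseteq> \<eta> ` {0..l}" .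
    have "abs_diff (ereal (primitive g (\<gamma> 0))) (ereal (primitive g (\<gamma> l))) =
        ennreal (primitive g b - primitive g a)"
      using primitive_diff(2)[OF assms, of a b]
      by (auto simp: abs_diff_def a_def b_def min_def max_def abs_if split: if_splits)
    also have "\<dots> = (\<integral>\<^sup>+t\<in>{a<..b}. g t \<partial>lborel)"
      by (intro primitive_diff assms) (simp add: a_def b_def)
    also have "\<dots> \<le> (\<integral>\<^sup>+t\<in>{a..b}. g t \<partial>lborel)"
      by (intro nn_integral_mono) (auto simp: indicator_def)
    also have "\<dots> \<le> (\<integral>\<^sup>+t\<in>{0..l}. g (\<eta> t) \<partial>lborel)"
      using ab lip \<open>l > 0\<close> by (intro nn_integral_le_Lipschitz_curve) auto
    also have "\<dots> = (\<integral>\<^sup>+t\<in>{0..l}. g (\<gamma> t) \<partial>lborel)"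
      using \<eta> by (intro nn_integral_cong) (auto simp: indicator_def)
    finally show ?thesis .
  qed
  then show ?thesis
    by (simp add: upper_gradient_on_def measurable_restrict_space1)
qed


section \<open>The Muckenhoupt condition\<close>

lemma ennreal_divide_antimono: "b \<le> c \<Longrightarrow> a / c \<le> a / (b :: ennreal)"
proof -
  assume "b \<le> c"
  then have "inverse c \<le> inverse b"
    including ennreal.lifting by transfer (auto intro: ereal_inverse_antimono)
  then show ?thesis
    by (simp add: divide_ennreal_def mult_left_mono)
qed

section \<open>Basic facts on complete Borel measures of the line\<close>

lemma measure_on_R_space:
  assumes "measure_on_R \<mu>"
  shows "space \<mu> = UNIV"
proof -
  obtain \<nu> where \<nu>: "sets \<nu> = sets borel" "\<mu> = completion \<nu>"
    using assms unfolding measure_on_R_def by blast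
  then show ?thesis
    using sets_eq_imp_space_eq[OF \<nu>(1)] by simp
qed

lemma measure_on_R_borel_sets:
  assumes "measure_on_R \<mu>" "A \<in> sets borel"
  shows "A \<in> sets \<mu>"
proof -
  obtain \<nu> where "sets \<nu> = sets borel" "\<mu> = completion \<nu>"
    using assms unfolding measure_on_R_def by blast
  then show ?thesis
    using assms by simp
qed

lemma measure_on_R_borel_measurable:
  assumes "measure_on_R \<mu>" "f \<in> borel \<rightarrow>\<^sub>M N"
  shows "f \<in> \<mu> \<rightarrow>\<^sub>M N"
proof (rule measurableI)
  show "f x \<in> space N" for x
    using measurable_space[OF assms(2)] by simp
  show "f -` A \<inter> space \<mu> \<in> sets \<mu>" if "A \<in> sets N" for A
    using measure_on_R_borel_sets[OF assms(1) measurable_sets[OF assms(2) that]]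
    by (simp add: measure_on_R_space[OF assms(1)])
qed

lemma measure_on_R_ball:
  assumes "measure_on_R \<mu>" "0 < r"
  shows "emeasure \<mu> (ball x r) \<noteq> 0" "emeasure \<mu> (ball x r) \<noteq> top"
proof -
  have "0 < emeasure \<mu> (ball x r) \<and> emeasure \<mu> (ball x r) < \<infinity>"
    using assms unfolding measure_on_R_def by blast
  then show "emeasure \<mu> (ball x r) \<noteq> 0" "emeasure \<mu> (ball x r) \<noteq> top"
    by auto
qed

text \<open>Testing against all Borel g expresses the condition without reference to a density of
  \<open>\<mu>\<close>. If \<open>\<mu>\<close> has a density w and p > 1, duality of Lebesgue
  spaces turns it into the usual A_p bound for w on the ball.\<close>

definition muckenhoupt_ball :: "real \<Rightarrow> real \<Rightarrow> real measure \<Rightarrow> real \<Rightarrow> real \<Rightarrow> bool" where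
  "muckenhoupt_ball p K \<mu> x r \<longleftrightarrow>
     (\<forall>g\<in>borel_measurable borel.
        (\<integral>\<^sup>+t\<in>ball x r. g t \<partial>lborel) \<le> ennreal (K * r) *
          ennreal_powr ((\<integral>\<^sup>+t\<in>ball x r. ennreal_powr (g t) p \<partial>\<mu>) / emeasure \<mu> (ball x r)) (1 / p))"

section \<open>From the Poincare inequality to the Muckenhoupt condition\<close>

text \<open>Doubling within B constrains only the smaller of the two balls, so it suffices that the
  last ball to be doubled lies in B; its double may leave B.\<close>

lemma doubling_within_iterate:
  assumes "doubling_within_with C \<mu> B" "0 < r" "ball x (2 ^ n * r / 2) \<subseteq> B" "0 < n"
  shows "emeasure \<mu> (ball x (2 ^ n * r)) \<le> ennreal C ^ n * emeasure \<mu> (ball x r)"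
  using assms(4,3)
proof (induction n rule: nat_induct_non_zero)
  case 1
  then show ?case
    using assms by (simp add: doubling_within_with_def)
next
  case (Suc n)
  have "ball x (2 ^ n * r / 2) \<subseteq> ball x (2 ^ Suc n * r / 2)"
    using assms by (intro subset_ball) simp
  with Suc have IH: "emeasure \<mu> (ball x (2 ^ n * r)) \<le> ennreal C ^ n * emeasure \<mu> (ball x r)"
    by auto
  have "emeasure \<mu> (ball x (2 * (2 ^ n * r))) \<le> ennreal C * emeasure \<mu> (ball x (2 ^ n * r))"
    using assms Suc by (simp add: doubling_within_with_def)
  also have "\<dots> \<le> ennreal C * (ennreal C ^ n * emeasure \<mu> (ball x r))"
    by (intro mult_left_mono IH) simp
  finally show ?case
    by (simp add: mult.assoc)
qed

lemma muckenhoupt_ball_if_bounded: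
  assumes \<mu>: "measure_on_R \<mu>" and "0 < p"
    and bounded: "\<And>g n. g \<in> borel_measurable borel \<Longrightarrow> (\<And>t. g t \<le> of_nat n) \<Longrightarrow>
      (\<integral>\<^sup>+t\<in>ball x r. g t \<partial>lborel) \<le> ennreal (K * r) *
        ennreal_powr ((\<integral>\<^sup>+t\<in>ball x r. ennreal_powr (g t) p \<partial>\<mu>) / emeasure \<mu> (ball x r)) (1 / p)"
  shows "muckenhoupt_ball p K \<mu> x r"
  unfolding muckenhoupt_ball_def
proof
  fix g :: "real \<Rightarrow> ennreal" assume [measurable]: "g \<in> borel_measurable borel"
  have "(\<integral>\<^sup>+t\<in>ball x r. min (g t) (of_nat n) \<partial>lborel) \<le> ennreal (K * r) *
      ennreal_powr ((\<integral>\<^sup>+t\<in>ball x r. ennreal_powr (g t) p \<partial>\<mu>) / emeasure \<mu> (ball x r)) (1 / p)" for n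
  proof -
    have "(\<integral>\<^sup>+t\<in>ball x r. min (g t) (of_nat n) \<partial>lborel) \<le> ennreal (K * r) *
        ennreal_powr ((\<integral>\<^sup>+t\<in>ball x r. ennreal_powr (min (g t) (of_nat n)) p \<partial>\<mu>) / emeasure \<mu> (ball x r)) (1 / p)"
      by (rule bounded[of _ n]) auto
    also have "\<dots> \<le> ennreal (K * r) *
        ennreal_powr ((\<integral>\<^sup>+t\<in>ball x r. ennreal_powr (g t) p \<partial>\<mu>) / emeasure \<mu> (ball x r)) (1 / p)"
      using \<open>0 < p\<close> by (intro mult_left_mono ennreal_powr_mono divide_right_mono_ennreal
          nn_integral_mono mult_right_mono) auto
    finally show ?thesis .
  qed
  then show "(\<integral>\<^sup>+t\<in>ball x r. g t \<partial>lborel) \<le> ennreal (K * r) *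
      ennreal_powr ((\<integral>\<^sup>+t\<in>ball x r. ennreal_powr (g t) p \<partial>\<mu>) / emeasure \<mu> (ball x r)) (1 / p)"
    by (subst nn_integral_SUP_min) (auto intro: SUP_least)
qed

lemma poincare_within_withD:
  assumes "poincare_within_with p C \<Lambda> \<mu> B" "0 < r" "ball x r \<subseteq> B"
    "integrable_ereal_on \<mu> (ball x (\<Lambda> * r)) u" "upper_gradient_on (ball x (\<Lambda> * r)) u g"
  shows "(\<integral>\<^sup>+y\<in>ball x r. e2ennreal \<bar>u y - ereal (mean_value \<mu> (ball x r) u)\<bar> \<partial>\<mu>)
      / emeasure \<mu> (ball x r)
    \<le> ennreal (C * r) * ennreal_powr ((\<integral>\<^sup>+y\<in>ball x (\<Lambda> * r). ennreal_powr (g y) p \<partial>\<mu>)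
        / emeasure \<mu> (ball x (\<Lambda> * r))) (1 / p)"
  using assms unfolding poincare_within_with_def by blast

text \<open>In the constant, 3 comes from the radius of \<open>ball y (3 * r)\<close>, on which the
  Poincare inequality is used, and D^3 compares the mass of that ball with the masses of its two
  outer thirds.\<close>

lemma muckenhoupt_ball_of_poincare:
  assumes \<mu>: "measure_on_R \<mu>" and "1 \<le> p"
    and D: "doubling_within_with D \<mu> (ball 0 R)" "0 < D"
    and P: "poincare_within_with p C \<Lambda> \<mu> (ball 0 R)" "0 < C" "1 \<le> \<Lambda>"
    and r: "0 < r" "\<bar>y\<bar> + 6 * r \<le> R"
  shows "muckenhoupt_ball p (3 * C * D ^ 3) \<mu> y r"
proof (rule muckenhoupt_ball_if_bounded[OF \<mu>])
  fix g :: "real \<Rightarrow> ennreal" and n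
  assume g[measurable]: "g \<in> borel_measurable borel" and le: "\<And>t. g t \<le> of_nat n"
  define h where "h = (\<lambda>t. g t * indicator (ball y r) t)"
  have [measurable]: "ball x \<rho> \<in> sets borel" for x \<rho> :: real
    by simp
  have [measurable]: "h \<in> borel_measurable borel"
    unfolding h_def by measurable
  have "(\<integral>\<^sup>+t. h t \<partial>lborel) \<le> (\<integral>\<^sup>+t\<in>ball y r. of_nat n \<partial>lborel)"
    unfolding h_def by (intro nn_integral_mono mult_right_mono le) simp
  also have "\<dots> < \<infinity>"
    using r by (simp add: nn_integral_cmult_indicator ball_eq_greaterThanLessThan
        ennreal_of_nat_eq_real_of_nat ennreal_mult_less_top)
  finally have fin: "(\<integral>\<^sup>+t. h t \<partial>lborel) < \<infinity>" .
  define a where "a = enn2real (\<integral>\<^sup>+t. h t \<partial>lborel)"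
  have a: "ennreal a = (\<integral>\<^sup>+t\<in>ball y r. g t \<partial>lborel)" "0 \<le> a"
    using fin by (simp_all add: a_def h_def)
  have u_left: "primitive h t = 0" if "t \<in> ball (y - 2 * r) r" for t
  proof -
    have "(\<integral>\<^sup>+s\<in>{..t}. h s \<partial>lborel) = (\<integral>\<^sup>+(s::real). 0 \<partial>lborel)"
      using that by (intro nn_integral_cong) (auto simp: h_def indicator_def dist_real_def abs_if split: if_splits)
    then show ?thesis
      by (simp add: primitive_def)
  qed
  have u_right: "primitive h t = a" if "t \<in> ball (y + 2 * r) r" for t
  proof -
    have "(\<integral>\<^sup>+s\<in>{..t}. h s \<partial>lborel) = (\<integral>\<^sup>+s. h s \<partial>lborel)"
      using that by (intro nn_integral_cong) (auto simp: h_def indicator_def dist_real_def abs_if split: if_splits)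
    then show ?thesis
      by (simp add: primitive_def a_def)
  qed
  have u_le: "primitive h t \<le> a" for t
    unfolding primitive_def a_def using fin
    by (intro enn2real_mono nn_integral_mono) (auto simp: indicator_def)
  have u_nonneg: "0 \<le> primitive h t" for t
    by (simp add: primitive_def)
  have "mono (primitive h)"
    using primitive_diff(2)[of h] fin by (intro monoI) auto
  then have u[measurable]: "primitive h \<in> borel_measurable borel"
    by (rule borel_measurable_mono)
  then have u\<mu>[measurable]: "primitive h \<in> borel_measurable \<mu>"
    by (rule measure_on_R_borel_measurable[OF \<mu>])
  have [measurable]: "ball x \<rho> \<in> sets \<mu>" for x \<rho> :: real
    by (rule measure_on_R_borel_sets[OF \<mu>]) simp
  let ?u = "\<lambda>t. ereal (primitive h t)"
  let ?B = "ball y (\<Lambda> * (3 * r))"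
  have r3: "r \<le> \<Lambda> * (3 * r)"
    using mult_mono[of 1 \<Lambda> r "3 * r"] P r by simp
  have int: "integrable_ereal_on \<mu> ?B ?u"
    unfolding integrable_ereal_on_def
  proof
    show "?u \<in> borel_measurable (restrict_space \<mu> ?B)"
      by (intro measurable_restrict_space1) measurable
    have "(\<integral>\<^sup>+t\<in>?B. e2ennreal \<bar>?u t\<bar> \<partial>\<mu>) \<le> (\<integral>\<^sup>+t\<in>?B. ennreal a \<partial>\<mu>)"
      using u_le u_nonneg by (intro nn_integral_mono mult_right_mono) (auto simp: ennreal_leI)
    also have "\<dots> < \<infinity>"
      using measure_on_R_ball[OF \<mu>, of "\<Lambda> * (3 * r)" y] r3 r
      by (simp add: nn_integral_cmult_indicator ennreal_mult_less_top less_top)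
    finally show "(\<integral>\<^sup>+t\<in>?B. e2ennreal \<bar>?u t\<bar> \<partial>\<mu>) < \<infinity>" .
  qed
  have ug: "upper_gradient_on ?B ?u h"
    by (rule upper_gradient_on_primitive) (use fin in auto)
  define m where "m = mean_value \<mu> (ball y (3 * r)) ?u"
  define I where "I = (\<integral>\<^sup>+t\<in>ball y (3 * r). e2ennreal \<bar>?u t - ereal m\<bar> \<partial>\<mu>)"
  have "ball y (3 * r) \<subseteq> ball 0 R"
    using r by (auto simp: dist_real_def abs_if split: if_splits)
  then have *: "I / emeasure \<mu> (ball y (3 * r)) \<le> ennreal (C * (3 * r)) *
      ennreal_powr ((\<integral>\<^sup>+t\<in>?B. ennreal_powr (h t) p \<partial>\<mu>) / emeasure \<mu> ?B) (1 / p)"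
    unfolding I_def m_def by (intro poincare_within_withD[OF P(1)] int ug) (use r in auto)
  \<comment> \<open>The ball around z of radius 5r contains \<open>ball y (3 * r)\<close>, and 5r <=
    2^3 r. The last ball doubled has radius 4r and a centre at distance 2r from y, which explains
    the room of 6r around y.\<close>
  have D3: "emeasure \<mu> (ball y (3 * r)) \<le> ennreal (D ^ 3) * emeasure \<mu> (ball z r)"
    if "\<bar>z - y\<bar> = 2 * r" for z
  proof -
    have "emeasure \<mu> (ball y (3 * r)) \<le> emeasure \<mu> (ball z (2 ^ 3 * r))"
      using that r by (intro emeasure_mono) (auto simp: dist_real_def abs_if split: if_splits)
    also have "\<dots> \<le> ennreal D ^ 3 * emeasure \<mu> (ball z r)"
      using that r by (intro doubling_within_iterate[OF D(1)])
        (auto simp: dist_real_def abs_if split: if_splits)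
    finally show ?thesis
      using D by (simp add: ennreal_power)
  qed
  \<comment> \<open>Whatever the mean m is, the plateau values 0 and a of the primitive deviate from
    it by |m| and |a - m|, together at least a. Each deviation is charged to the plateau where it
    occurs, and the two plateaus are disjoint parts of \<open>ball y (3 * r)\<close>.\<close>
  have "ennreal a * emeasure \<mu> (ball y (3 * r)) \<le>
      (ennreal \<bar>m\<bar> + ennreal \<bar>a - m\<bar>) * emeasure \<mu> (ball y (3 * r))"
    by (intro mult_right_mono) (auto simp: ennreal_leI simp flip: ennreal_plus)
  also have "\<dots> \<le> ennreal \<bar>m\<bar> * (ennreal (D ^ 3) * emeasure \<mu> (ball (y - 2 * r) r)) +
      ennreal \<bar>a - m\<bar> * (ennreal (D ^ 3) * emeasure \<mu> (ball (y + 2 * r) r))"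
    unfolding distrib_right using r by (intro add_mono mult_left_mono D3) auto
  also have "\<dots> = ennreal (D ^ 3) * (\<integral>\<^sup>+t. ennreal \<bar>m\<bar> * indicator (ball (y - 2 * r) r) t +
      ennreal \<bar>a - m\<bar> * indicator (ball (y + 2 * r) r) t \<partial>\<mu>)"
    by (subst nn_integral_add) (auto simp: nn_integral_cmult_indicator algebra_simps)
  also have "\<dots> \<le> ennreal (D ^ 3) * I"
    unfolding I_def
  proof (intro mult_left_mono nn_integral_mono)
    fix t
    consider "t \<in> ball (y - 2 * r) r" | "t \<in> ball (y + 2 * r) r"
      | "t \<notin> ball (y - 2 * r) r" "t \<notin> ball (y + 2 * r) r"
      by blast
    then show "ennreal \<bar>m\<bar> * indicator (ball (y - 2 * r) r) t +
        ennreal \<bar>a - m\<bar> * indicator (ball (y + 2 * r) r) t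
      \<le> e2ennreal \<bar>?u t - ereal m\<bar> * indicator (ball y (3 * r)) t"
    proof cases
      case 1
      then have "t \<notin> ball (y + 2 * r) r" "t \<in> ball y (3 * r)"
        by (auto simp: dist_real_def abs_if split: if_splits)
      then show ?thesis
        using 1 u_left[OF 1] by simp
    next
      case 2
      then have "t \<notin> ball (y - 2 * r) r" "t \<in> ball y (3 * r)"
        by (auto simp: dist_real_def abs_if split: if_splits)
      then show ?thesis
        using 2 u_right[OF 2] by simp
    qed simp
  qed simp
  finally have "ennreal a * emeasure \<mu> (ball y (3 * r)) / emeasure \<mu> (ball y (3 * r)) \<le>
      ennreal (D ^ 3) * I / emeasure \<mu> (ball y (3 * r))"
    by (rule divide_right_mono_ennreal)
  then have "ennreal a \<le> ennreal (D ^ 3) * (I / emeasure \<mu> (ball y (3 * r)))"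
    using measure_on_R_ball[OF \<mu>, of "3 * r" y] r
    by (simp add: ennreal_mult_divide_eq ennreal_times_divide)
  also have "\<dots> \<le> ennreal (D ^ 3) * (ennreal (C * (3 * r)) *
      ennreal_powr ((\<integral>\<^sup>+t\<in>?B. ennreal_powr (h t) p \<partial>\<mu>) / emeasure \<mu> ?B) (1 / p))"
    by (intro mult_left_mono *) simp
  also have "\<dots> = ennreal (3 * C * D ^ 3 * r) *
      ennreal_powr ((\<integral>\<^sup>+t\<in>?B. ennreal_powr (h t) p \<partial>\<mu>) / emeasure \<mu> ?B) (1 / p)"
    using D P r by (simp flip: ennreal_mult mult.assoc) (simp add: mult_ac)
  \<comment> \<open>The dilation costs nothing: h vanishes off \<open>ball y r\<close>, so the
    numerator does not see the dilated ball, and passing to the smaller mass of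
    \<open>ball y r\<close> in the denominator only increases the quotient.\<close>
  also have "(\<integral>\<^sup>+t\<in>?B. ennreal_powr (h t) p \<partial>\<mu>) = (\<integral>\<^sup>+t\<in>ball y r. ennreal_powr (g t) p \<partial>\<mu>)"
    using subset_ball[OF r3, of y] unfolding h_def ennreal_powr_indicator
    by (intro nn_integral_cong) (auto simp: indicator_def)
  also have "ennreal (3 * C * D ^ 3 * r) *
      ennreal_powr ((\<integral>\<^sup>+t\<in>ball y r. ennreal_powr (g t) p \<partial>\<mu>) / emeasure \<mu> ?B) (1 / p) \<le>
    ennreal (3 * C * D ^ 3 * r) *
      ennreal_powr ((\<integral>\<^sup>+t\<in>ball y r. ennreal_powr (g t) p \<partial>\<mu>) / emeasure \<mu> (ball y r)) (1 / p)"
    using \<open>1 \<le> p\<close> subset_ball[OF r3, of y]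
    by (intro mult_left_mono ennreal_powr_mono)
      (auto intro!: ennreal_divide_antimono emeasure_mono)
  finally show "(\<integral>\<^sup>+t\<in>ball y r. g t \<partial>lborel) \<le> ennreal (3 * C * D ^ 3 * r) *
      ennreal_powr ((\<integral>\<^sup>+t\<in>ball y r. ennreal_powr (g t) p \<partial>\<mu>) / emeasure \<mu> (ball y r)) (1 / p)"
    by (simp add: a)
qed (use \<open>1 \<le> p\<close> in simp)

section \<open>Cutting an interval into pieces of a fixed scale\<close>

text \<open>The pieces are half-open intervals of length \<open>2 * \<rho>\<close>, the first one
  without its left end. As they are not all balls, each is only enclosed between concentric balls of
  radii \<open>\<rho>\<close> and \<open>2 * \<rho>\<close>.\<close>

lemma ball_partition:
  fixes x r R :: real
  assumes "0 < R" "R / 2 \<le> r"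
  obtains n :: nat and \<rho> :: real and J :: "nat \<Rightarrow> real set" and z :: "nat \<Rightarrow> real"
  where "0 < n" "n * \<rho> = r" "R / 4 \<le> \<rho>" "\<rho> \<le> R / 2"
    "\<And>j. J j \<in> sets borel" "disjoint_family_on J {..<n}" "(\<Union>j<n. J j) = ball x r"
    "\<And>j. j < n \<Longrightarrow> ball (z j) \<rho> \<subseteq> J j" "\<And>j. J j \<subseteq> ball (z j) (2 * \<rho>)"
proof -
  \<comment> \<open>Rounding up gives 2r/R <= n <= 2r/R + 1, and the upper bound is at most 4r/R
    because 2r >= R. Hence r/n lies between R/4 and R/2.\<close>
  define n where "n = nat \<lceil>2 * r / R\<rceil>"
  define \<rho> where "\<rho> = r / n"
  define J where "J j = {t \<in> ball x r. \<lfloor>(t - (x - r)) / (2 * \<rho>)\<rfloor> = int j}" for j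
  define z where "z j = x - r + (2 * real j + 1) * \<rho>" for j
  have r: "0 < r" "1 \<le> 2 * r / R"
    using assms by (auto simp: field_simps)
  have n: "2 * r / R \<le> n" "n \<le> 2 * r / R + 1"
    using r by (simp_all add: n_def of_nat_nat)
  have "0 < n"
    using n r by (auto intro: gr0I)
  have "n \<le> 4 * r / R"
    using n(2) r(2) by simp
  then have \<rho>: "R / 4 \<le> \<rho>" "\<rho> \<le> R / 2" "n * \<rho> = r" "0 < \<rho>"
    using n(1) assms r \<open>0 < n\<close> by (auto simp: \<rho>_def field_simps)
  have J_iff: "t \<in> J j \<longleftrightarrow> t \<in> ball x r \<and> x - r + 2 * real j * \<rho> \<le> t \<and> t < x - r + 2 * (real j + 1) * \<rho>" for t j
    using \<rho>(4) by (auto simp: J_def floor_eq_iff field_simps)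
  show thesis
  proof (rule that[OF \<open>0 < n\<close> \<rho>(3,1,2)])
    show "J j \<in> sets borel" for j
    proof -
      have "J j = ball x r \<inter> {x - r + 2 * real j * \<rho> ..< x - r + 2 * (real j + 1) * \<rho>}"
        using J_iff by auto
      then show ?thesis
        by simp
    qed
    show "disjoint_family_on J {..<n}"
      by (auto simp: disjoint_family_on_def J_def)
    show "(\<Union>j<n. J j) = ball x r"
    proof
      show "ball x r \<subseteq> (\<Union>j<n. J j)"
      proof
        fix t assume t: "t \<in> ball x r"
        define k where "k = \<lfloor>(t - (x - r)) / (2 * \<rho>)\<rfloor>"
        have t': "x - r < t" "t < x + r"
          using t by (auto simp: dist_real_def)
        then have "0 \<le> k"
          using \<rho>(4) by (simp add: k_def)
        moreover have "(t - (x - r)) / (2 * \<rho>) < n"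
          using t' \<rho> by (simp add: field_simps)
        then have "k < int n"
          unfolding k_def by linarith
        ultimately show "t \<in> (\<Union>j<n. J j)"
          using t by (intro UN_I[of "nat k"]) (auto simp: J_def k_def nat_less_iff)
      qed
    qed (auto simp: J_def)
    show "ball (z j) \<rho> \<subseteq> J j" if "j < n" for j
    proof
      fix t assume "t \<in> ball (z j) \<rho>"
      then have t: "x - r + 2 * (real j * \<rho>) < t" "t < x - r + 2 * (real j * \<rho>) + 2 * \<rho>"
        by (auto simp: dist_real_def z_def algebra_simps abs_less_iff)
      have "(real j + 1) * \<rho> \<le> n * \<rho>"
        using that \<rho>(4) by (intro mult_right_mono) auto
      then have "real j * \<rho> + \<rho> \<le> r"
        using \<rho>(3) by (simp add: algebra_simps)
      moreover have "0 \<le> real j * \<rho>"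
        using \<rho>(4) by simp
      ultimately have "x - r < t" "t < x + r"
        using t by linarith+
      then show "t \<in> J j"
        using t by (auto simp: J_iff dist_real_def algebra_simps)
    qed
    show "J j \<subseteq> ball (z j) (2 * \<rho>)" for j
      using \<rho>(4) by (auto simp: J_iff z_def dist_real_def abs_less_iff algebra_simps)
  qed
qed

section \<open>From the Muckenhoupt condition to the Poincare inequality\<close>

text \<open>Two points of the ball are joined by a segment inside it, so u varies by at most the
  integral G of g over the ball, and the mean of u lies within G of every value. No dilation
  enters.\<close>

lemma poincare_of_muckenhoupt_ball:
  assumes sets: "\<And>A. A \<in> sets borel \<Longrightarrow> A \<in> sets \<mu>" and space: "space \<mu> = UNIV"
    and "0 < r" and fin: "0 < emeasure \<mu> (ball x r)" "emeasure \<mu> (ball x r) < \<infinity>"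
    and muck: "muckenhoupt_ball p K \<mu> x r"
    and int: "integrable_ereal_on \<mu> (ball x r) u" and ug: "upper_gradient_on (ball x r) u g"
  shows "(\<integral>\<^sup>+y\<in>ball x r. e2ennreal \<bar>u y - ereal (mean_value \<mu> (ball x r) u)\<bar> \<partial>\<mu>)
      / emeasure \<mu> (ball x r)
    \<le> ennreal (K * r) * ennreal_powr ((\<integral>\<^sup>+y\<in>ball x r. ennreal_powr (g y) p \<partial>\<mu>)
        / emeasure \<mu> (ball x r)) (1 / p)"
proof -
  define B where "B = ball x r"
  have [measurable]: "B \<in> sets borel"
    by (simp add: B_def)
  have B\<mu>[measurable]: "B \<in> sets \<mu>"
    by (rule sets) simp
  \<comment> \<open>The upper gradient is Borel only on B; extension by 0 gives a Borel function on
    the line to which the Muckenhoupt condition applies.\<close>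
  define h where "h = (\<lambda>t. g t * indicator B t)"
  have h[measurable]: "h \<in> borel_measurable borel"
    using ug borel_measurable_restrict_space_iff_ennreal[of B borel g]
    by (simp add: upper_gradient_on_def h_def B_def)
  define G where "G = (\<integral>\<^sup>+t\<in>B. h t \<partial>lborel)"
  have "G \<le> ennreal (K * r) *
      ennreal_powr ((\<integral>\<^sup>+t\<in>B. ennreal_powr (h t) p \<partial>\<mu>) / emeasure \<mu> B) (1 / p)"
    using muck h unfolding muckenhoupt_ball_def G_def B_def by blast
  also have "(\<integral>\<^sup>+t\<in>B. ennreal_powr (h t) p \<partial>\<mu>) = (\<integral>\<^sup>+t\<in>B. ennreal_powr (g t) p \<partial>\<mu>)"
    by (intro nn_integral_cong) (simp add: h_def indicator_def)
  finally have G: "G \<le> ennreal (K * r) *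
      ennreal_powr ((\<integral>\<^sup>+t\<in>B. ennreal_powr (g t) p \<partial>\<mu>) / emeasure \<mu> B) (1 / p)" .
  have "(\<integral>\<^sup>+y\<in>B. e2ennreal \<bar>u y - ereal (mean_value \<mu> B u)\<bar> \<partial>\<mu>) / emeasure \<mu> B \<le> G"
  proof (cases "G = \<infinity>")
    case False
    then obtain c where c: "G = ennreal c" "0 \<le> c"
      by (metis ennreal_cases infinity_ennreal_def)
    have osc_less: "abs_diff (u s) (u t) \<le> G" if "s \<in> B" "t \<in> B" "s < t" for s t
    proof -
      have sub: "{s..t} \<subseteq> B"
        using that by (auto simp: B_def dist_real_def)
      have "abs_diff (u (s + 0)) (u (s + (t - s))) \<le> (\<integral>\<^sup>+\<tau>\<in>{0..t - s}. g (s + \<tau>) \<partial>lborel)"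
        using ug arc_length_curve_segment[OF \<open>s < t\<close> sub]
        unfolding upper_gradient_on_def B_def by blast
      also have "\<dots> = (\<integral>\<^sup>+\<tau>. h (s + 1 * \<tau>) * indicator {s..t} (s + 1 * \<tau>) \<partial>lborel)"
        using sub by (intro nn_integral_cong) (auto simp: h_def indicator_def subset_iff)
      also have "\<dots> = (\<integral>\<^sup>+\<tau>. h \<tau> * indicator {s..t} \<tau> \<partial>lborel)"
        using nn_integral_real_affine[of "\<lambda>\<tau>. h \<tau> * indicator {s..t} \<tau>" 1 s] by simp
      also have "\<dots> \<le> G"
        unfolding G_def using sub by (intro nn_integral_mono) (auto simp: indicator_def)
      finally show ?thesis
        by simp
    qed
    have osc: "abs_diff (u s) (u t) \<le> G" if "s \<in> B" "t \<in> B" "s \<noteq> t" for s t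
    proof (cases "s < t")
      case False
      have "abs_diff (u s) (u t) = abs_diff (u t) (u s)"
        by (cases "u s"; cases "u t") (auto simp: abs_diff_def abs_minus_commute)
      then show ?thesis
        using False osc_less[of t s] that by simp
    qed (use osc_less that in blast)
    \<comment> \<open>\<open>abs_diff\<close> is infinite as soon as one value is, so finite
      oscillation excludes infinite values. A second point of B is needed because curves are
      nonconstant.\<close>
    have u_fin: "\<bar>u s\<bar> \<noteq> \<infinity>" if "s \<in> B" for s
    proof -
      obtain t where "t \<in> B" "t \<noteq> s"
      proof (cases "s = x")
        case True
        with that[of "x + r / 2"] \<open>0 < r\<close> show ?thesis
          by (auto simp: B_def dist_real_def)
      next
        case False
        with that[of x] \<open>0 < r\<close> show ?thesis
          by (auto simp: B_def)
      qed
      then show ?thesis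
        using osc[of s t] \<open>s \<in> B\<close> c by (auto simp: abs_diff_def top_unique)
    qed
    define v where "v t = real_of_ereal (u t)" for t
    have u_v: "u t = ereal (v t)" if "t \<in> B" for t
      using u_fin[OF that] by (simp add: v_def ereal_real)
    have v_osc: "\<bar>v s - v t\<bar> \<le> c" if "s \<in> B" "t \<in> B" for s t
    proof (cases "s = t")
      case False
      then show ?thesis
        using osc[OF that False] c that by (simp add: u_v abs_diff_def)
    qed (use c in simp)
    have "u \<in> borel_measurable (restrict_space \<mu> B)"
      using int by (simp add: integrable_ereal_on_def B_def)
    then have "v \<in> borel_measurable (restrict_space \<mu> B)"
      unfolding v_def by measurable
    then have [measurable]: "(\<lambda>t. indicator B t *\<^sub>R v t) \<in> borel_measurable \<mu>"
      using borel_measurable_restrict_space_iff[of B \<mu> v] B\<mu> by (simp add: space)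
    define m where "m = mean_value \<mu> B u"
    have mB: "measure \<mu> B > 0" "emeasure \<mu> B < \<infinity>"
      using fin by (simp_all add: B_def measure_def enn2real_positive_iff)
    \<comment> \<open>On B all values of v lie within c of v t. Hence v is bounded, thus integrable
      over B, and averaging keeps it within c of v t.\<close>
    have "\<bar>v t - m\<bar> \<le> c" if "t \<in> B" for t
    proof -
      have intg: "integrable \<mu> (\<lambda>s. indicator B s *\<^sub>R (indicator B s *\<^sub>R v s))"
      proof (rule integrableI_bounded_set_indicator[of _ _ _ "\<bar>v t\<bar> + c"])
        show "AE s in \<mu>. s \<in> B \<longrightarrow> norm (indicator B s *\<^sub>R v s) \<le> \<bar>v t\<bar> + c"
        proof (intro AE_I2 impI)
          fix s assume "s \<in> B"
          with v_osc[OF this that] show "norm (indicator B s *\<^sub>R v s) \<le> \<bar>v t\<bar> + c"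
            by simp
        qed
        show "(\<lambda>s. indicator B s *\<^sub>R v s) \<in> borel_measurable \<mu>"
          by measurable
      qed (use mB in auto)
      have intg_const: "integrable \<mu> (\<lambda>s. indicator B s *\<^sub>R d)" for d :: real
        using mB by (intro integrable_indicator) auto
      have eq: "(LINT s:B|\<mu>. v s) = (LINT s|\<mu>. indicator B s *\<^sub>R (indicator B s *\<^sub>R v s))"
        unfolding set_lebesgue_integral_def by (intro Bochner_Integration.integral_cong) (auto simp: indicator_def)
      have "(LINT s|\<mu>. indicator B s *\<^sub>R (v t - c)) \<le> (LINT s:B|\<mu>. v s)"
        unfolding eq using v_osc that
        by (intro integral_mono intg intg_const) (auto simp: indicator_def abs_le_iff algebra_simps)
      moreover have "(LINT s:B|\<mu>. v s) \<le> (LINT s|\<mu>. indicator B s *\<^sub>R (v t + c))"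
        unfolding eq using v_osc that
        by (intro integral_mono intg intg_const) (auto simp: indicator_def abs_le_iff algebra_simps)
      moreover have "(LINT s:B|\<mu>. v s) = m * measure \<mu> B"
        using mB by (simp add: m_def mean_value_def v_def)
      ultimately have "(v t - c) * measure \<mu> B \<le> m * measure \<mu> B"
          "m * measure \<mu> B \<le> (v t + c) * measure \<mu> B"
        by (simp_all add: space mult.commute)
      then show ?thesis
        using mB by (simp add: abs_le_iff)
    qed
    then have "(\<integral>\<^sup>+y\<in>B. e2ennreal \<bar>u y - ereal m\<bar> \<partial>\<mu>) \<le> (\<integral>\<^sup>+y\<in>B. G \<partial>\<mu>)"
      by (intro nn_integral_mono) (auto simp: indicator_def u_v c ennreal_leI)
    also have "\<dots> = G * emeasure \<mu> B"
      by (simp add: nn_integral_cmult_indicator)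
    finally have "(\<integral>\<^sup>+y\<in>B. e2ennreal \<bar>u y - ereal m\<bar> \<partial>\<mu>) / emeasure \<mu> B \<le> G * emeasure \<mu> B / emeasure \<mu> B"
      by (rule divide_right_mono_ennreal)
    also have "\<dots> = G"
      using fin by (intro ennreal_mult_divide_eq) (auto simp: B_def)
    finally show ?thesis
      by (simp add: m_def)
  qed simp
  also note G
  finally show ?thesis
    by (simp add: B_def)
qed


section \<open>From small to large scales\<close>

text \<open>All estimates hold at radii up to R uniformly in the centre. The two mass bounds govern
  larger balls: a piece of the partition contains a ball of radius R/4 and lies in a ball of radius
  R, so its mass is between c and C.\<close>

locale uniform_small_scale =
  fixes \<mu> :: "real measure" and p R D K c C :: real
  assumes sets: "\<And>A. A \<in> sets borel \<Longrightarrow> A \<in> sets \<mu>" and space: "space \<mu> = UNIV"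
    and p: "1 \<le> p" and pos: "0 < R" "0 < D" "0 < K" "0 < c" "c \<le> C"
    and doubling: "\<And>x r. 0 < r \<Longrightarrow> r \<le> R \<Longrightarrow>
      emeasure \<mu> (ball x (2 * r)) \<le> ennreal D * emeasure \<mu> (ball x r)"
    and lower: "\<And>x. ennreal c \<le> emeasure \<mu> (ball x (R / 4))"
    and upper: "\<And>x. emeasure \<mu> (ball x R) \<le> ennreal C"
    and muckenhoupt: "\<And>x r. 0 < r \<Longrightarrow> r \<le> R \<Longrightarrow> muckenhoupt_ball p K \<mu> x r"
begin

lemma ball_sets [measurable, simp]: "ball x r \<in> sets \<mu>"
  by (rule sets) simp

lemma borel_measurable_of_borel:
  fixes f :: "real \<Rightarrow> 'a::topological_space"
  shows "f \<in> borel_measurable borel \<Longrightarrow> f \<in> borel_measurable \<mu>"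
proof (rule measurableI)
  fix A :: "'a set" assume "f \<in> borel_measurable borel" "A \<in> sets borel"
  then show "f -` A \<inter> space \<mu> \<in> sets \<mu>"
    using sets[OF measurable_sets[of f borel borel A]] by (simp add: space)
qed simp

text \<open>The ball splits into n pieces of mass between c and C, where n is between 2r/R and
  4r/R.\<close>

lemma linear_growth:
  assumes "R / 2 \<le> r"
  shows "ennreal (2 * r / R * c) \<le> emeasure \<mu> (ball x r)"
    and "emeasure \<mu> (ball x r) \<le> ennreal (4 * r / R * C)"
proof -
  obtain n \<rho> J z where *: "0 < n" "real n * \<rho> = r" "R / 4 \<le> \<rho>" "\<rho> \<le> R / 2"
    "\<And>j. J j \<in> sets borel" "disjoint_family_on J {..<n}" "(\<Union>j<n. J j) = ball x r"
    "\<And>j. j < n \<Longrightarrow> ball (z j) \<rho> \<subseteq> J j" "\<And>j. J j \<subseteq> ball (z j) (2 * \<rho>)"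
    by (rule ball_partition[OF pos(1) assms, of x]) (rule that)
  have n: "2 * r / R \<le> n" "n \<le> 4 * r / R"
  proof -
    have "n * (2 * \<rho>) \<le> n * R" "n * R \<le> n * (4 * \<rho>)"
      using *(3,4) by (intro mult_left_mono; simp)+
    then show "2 * r / R \<le> n" "n \<le> 4 * r / R"
      using *(2) pos by (auto simp: field_simps)
  qed
  have sum: "emeasure \<mu> (ball x r) = (\<Sum>j<n. emeasure \<mu> (J j))"
    unfolding *(7)[symmetric] using * sets by (intro sum_emeasure[symmetric]) auto
  have J: "ennreal c \<le> emeasure \<mu> (J j)" "emeasure \<mu> (J j) \<le> ennreal C" if "j < n" for j
  proof -
    have "emeasure \<mu> (ball (z j) (R / 4)) \<le> emeasure \<mu> (J j)"
      using *(8)[OF that] *(3,5) sets subset_ball[of "R / 4" \<rho> "z j"] by (intro emeasure_mono) auto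
    then show "ennreal c \<le> emeasure \<mu> (J j)"
      using lower[of "z j"] by (rule order_trans[rotated])
    have "emeasure \<mu> (J j) \<le> emeasure \<mu> (ball (z j) R)"
      using *(9)[of j] *(4) subset_ball[of "2 * \<rho>" R "z j"] by (intro emeasure_mono) auto
    then show "emeasure \<mu> (J j) \<le> ennreal C"
      using upper[of "z j"] by (rule order_trans)
  qed
  have "ennreal (2 * r / R * c) \<le> ennreal (n * c)"
    using n pos by (intro ennreal_leI mult_right_mono) auto
  also have "\<dots> = (\<Sum>j<n. ennreal c)"
    using pos by (simp add: ennreal_mult ennreal_of_nat_eq_real_of_nat)
  also have "\<dots> \<le> emeasure \<mu> (ball x r)"
    unfolding sum using J by (intro sum_mono) auto
  finally show "ennreal (2 * r / R * c) \<le> emeasure \<mu> (ball x r)" .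
  have "emeasure \<mu> (ball x r) \<le> (\<Sum>j<n. ennreal C)"
    unfolding sum using J by (intro sum_mono) auto
  also have "\<dots> = ennreal (n * C)"
    using pos by (simp add: ennreal_mult ennreal_of_nat_eq_real_of_nat)
  also have "\<dots> \<le> ennreal (4 * r / R * C)"
    using n pos by (intro ennreal_leI mult_right_mono) auto
  finally show "emeasure \<mu> (ball x r) \<le> ennreal (4 * r / R * C)" .
qed

lemma ball_pos_finite:
  assumes "0 < r"
  shows "0 < emeasure \<mu> (ball x r)" "emeasure \<mu> (ball x r) < \<infinity>"
proof -
  show "emeasure \<mu> (ball x r) < \<infinity>"
  proof -
    have "emeasure \<mu> (ball x r) \<le> emeasure \<mu> (ball x (max r (R / 2)))"
      by (intro emeasure_mono subset_ball) auto
    also have "\<dots> \<le> ennreal (4 * max r (R / 2) / R * C)"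
      by (rule linear_growth) simp
    finally show ?thesis
      by (simp add: order_le_less_trans)
  qed
  \<comment> \<open>Positivity descends from scale R by halving: if a ball of radius at most R were
    null, doubling would make its double null. Radii above R are covered by the lower mass
    bound.\<close>
  have *: "emeasure \<mu> (ball x s) \<noteq> 0" if "R / 2 ^ n \<le> s" "0 < s" for s n
    using that
  proof (induction n arbitrary: s)
    case 0
    have "0 < ennreal c"
      using pos by simp
    also have "\<dots> \<le> emeasure \<mu> (ball x (R / 4))"
      by (rule lower)
    also have "\<dots> \<le> emeasure \<mu> (ball x s)"
      using 0 pos by (intro emeasure_mono subset_ball) auto
    finally show ?case
      by simp
  next
    case (Suc n)
    have "emeasure \<mu> (ball x (2 * s)) \<noteq> 0"
      using Suc by (intro Suc.IH) (auto simp: field_simps)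
    show ?case
    proof (cases "s \<le> R")
      case True
      with doubling[OF \<open>0 < s\<close> this, of x] \<open>emeasure \<mu> (ball x (2 * s)) \<noteq> 0\<close> show ?thesis
        by auto
    next
      case False
      then have "emeasure \<mu> (ball x (R / 4)) \<le> emeasure \<mu> (ball x s)"
        using pos by (intro emeasure_mono subset_ball) auto
      with lower[of x] pos show ?thesis
        by (metis ennreal_eq_0_iff le_zero_eq not_less)
    qed
  qed
  obtain n where "R / r < 2 ^ n"
    using real_arch_pow[of 2 "R / r"] by auto
  then have "R / 2 ^ n \<le> r"
    using assms by (simp add: field_simps)
  from *[OF this assms] show "0 < emeasure \<mu> (ball x r)"
    by (simp add: zero_less_iff_neq_zero)
qed

text \<open>For r > R, linear growth gives at most 8rC/R for the doubled ball and at least 2rc/R for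
  the ball itself; the quotient is 4C/c. The sum of constants serves both ranges.\<close>

lemma doubling_all:
  assumes "0 < r"
  shows "emeasure \<mu> (ball x (2 * r)) \<le> ennreal (D + 4 * C / c) * emeasure \<mu> (ball x r)"
proof (cases "r \<le> R")
  case True
  have "emeasure \<mu> (ball x (2 * r)) \<le> ennreal D * emeasure \<mu> (ball x r)"
    by (rule doubling[OF assms True])
  also have "\<dots> \<le> ennreal (D + 4 * C / c) * emeasure \<mu> (ball x r)"
    using pos by (intro mult_right_mono ennreal_leI) auto
  finally show ?thesis .
next
  case False
  have "emeasure \<mu> (ball x (2 * r)) \<le> ennreal (4 * (2 * r) / R * C)"
    using False pos by (intro linear_growth) auto
  also have "\<dots> = ennreal (4 * C / c) * ennreal (2 * r / R * c)"
    using assms pos by (subst ennreal_mult[symmetric]) (auto simp: field_simps)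
  also have "\<dots> \<le> ennreal (D + 4 * C / c) * emeasure \<mu> (ball x r)"
    using False pos by (intro mult_mono linear_growth ennreal_leI) auto
  finally show ?thesis .
qed

text \<open>The small scale condition bounds the integral over each piece, and the power mean
  inequality adds these bounds up. The factor 4 combines the radius \<open>2 * \<rho>\<close> of the
  balls around the pieces with the 2 of \<open>sum_powr_le\<close>; C/c is the ratio of the mass
  bounds.\<close>

lemma muckenhoupt_large:
  assumes r: "R / 2 \<le> r"
  shows "muckenhoupt_ball p (4 * K * (C / c)) \<mu> x r"
  unfolding muckenhoupt_ball_def
proof
  fix g :: "real \<Rightarrow> ennreal" assume g[measurable]: "g \<in> borel_measurable borel"
  note [measurable] = borel_measurable_of_borel[OF g]
  obtain n \<rho> J z where *: "0 < n" "real n * \<rho> = r" "R / 4 \<le> \<rho>" "\<rho> \<le> R / 2"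
    "\<And>j. J j \<in> sets borel" "disjoint_family_on J {..<n}" "(\<Union>j<n. J j) = ball x r"
    "\<And>j. j < n \<Longrightarrow> ball (z j) \<rho> \<subseteq> J j" "\<And>j. J j \<subseteq> ball (z j) (2 * \<rho>)"
    by (rule ball_partition[OF pos(1) r, of x]) (rule that)
  note [measurable] = *(5) sets[OF *(5)]
  have r0: "0 < r"
    using r pos by simp
  have split: "indicator (ball x r) t = (\<Sum>j<n. indicator (J j) t :: ennreal)" for t
    unfolding *(7)[symmetric] using *(6) by (intro indicator_UN_disjoint) auto
  define q where "q = 1 / p"
  have q: "0 < q" "q \<le> 1"
    using p by (auto simp: q_def)
  let ?G = "\<lambda>t. ennreal_powr (g t) p"
  let ?A = "\<integral>\<^sup>+t\<in>ball x r. ?G t \<partial>\<mu>"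
  have A: "?A = (\<Sum>j<n. \<integral>\<^sup>+t\<in>J j. ?G t \<partial>\<mu>)"
    unfolding split sum_distrib_left by (intro nn_integral_sum) measurable
  have "(\<integral>\<^sup>+t\<in>ball x r. g t \<partial>lborel) \<le> ennreal (4 * K * r) * ennreal_powr (ennreal (C / c) * (?A / emeasure \<mu> (ball x r))) q"
  proof (cases "?A = \<infinity>")
    case True
    have "?A / emeasure \<mu> (ball x r) = \<infinity>"
      using True ball_pos_finite[OF r0, of x] by (simp add: ennreal_divide_eq_top_iff less_top)
    then show ?thesis
      using pos r0 by (simp add: ennreal_mult_top ennreal_powr_def)
  next
    case False
    define a where "a j = enn2real (\<integral>\<^sup>+t\<in>J j. ?G t \<partial>\<mu>)" for j
    have a: "(\<integral>\<^sup>+t\<in>J j. ?G t \<partial>\<mu>) = ennreal (a j)" "0 \<le> a j" if "j < n" for j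
    proof -
      have "(\<integral>\<^sup>+t\<in>J j. ?G t \<partial>\<mu>) \<le> ?A"
        using *(7) that by (intro nn_integral_mono mult_left_mono) (auto simp: indicator_def)
      then show "(\<integral>\<^sup>+t\<in>J j. ?G t \<partial>\<mu>) = ennreal (a j)" "0 \<le> a j"
        using False by (auto simp: a_def less_top le_less_trans)
    qed
    have "?A = (\<Sum>j<n. ennreal (a j))"
      unfolding A using a by (intro sum.cong) auto
    also have "\<dots> = ennreal (\<Sum>j<n. a j)"
      using a(2) by (intro sum_ennreal) auto
    finally have A_eq: "?A = ennreal (\<Sum>j<n. a j)" .
    have a_sum: "0 \<le> (\<Sum>j<n. a j)"
      using a(2) by (intro sum_nonneg) auto
    have piece: "(\<integral>\<^sup>+t\<in>J j. g t \<partial>lborel) \<le> ennreal (K * (2 * \<rho>) * (a j / c) powr q)" if "j < n" for j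
    proof -
      \<comment> \<open>The condition is used on a ball around J j, of radius at most R, for g cut
        off to J j.\<close>
      let ?B = "ball (z j) (2 * \<rho>)"
      have "(\<integral>\<^sup>+t\<in>J j. g t \<partial>lborel) = (\<integral>\<^sup>+t\<in>?B. g t * indicator (J j) t \<partial>lborel)"
        using *(9)[of j] by (intro nn_integral_cong) (auto simp: indicator_def)
      also have "\<dots> \<le> ennreal (K * (2 * \<rho>)) *
          ennreal_powr ((\<integral>\<^sup>+t\<in>?B. ennreal_powr (g t * indicator (J j) t) p \<partial>\<mu>) / emeasure \<mu> ?B) (1 / p)"
        using muckenhoupt[of "2 * \<rho>" "z j"] *(3,4) pos unfolding muckenhoupt_ball_def
        by (auto elim!: ballE[of _ _ "\<lambda>t. g t * indicator (J j) t"])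
      also have "(\<integral>\<^sup>+t\<in>?B. ennreal_powr (g t * indicator (J j) t) p \<partial>\<mu>) = ennreal (a j)"
        unfolding a(1)[OF that, symmetric] ennreal_powr_indicator
        using *(9)[of j] by (intro nn_integral_cong) (auto simp: indicator_def)
      also have "ennreal (K * (2 * \<rho>)) * ennreal_powr (ennreal (a j) / emeasure \<mu> ?B) (1 / p)
          \<le> ennreal (K * (2 * \<rho>)) * ennreal_powr (ennreal (a j) / ennreal c) (1 / p)"
      proof (intro mult_left_mono ennreal_powr_mono ennreal_divide_antimono)
        have "ennreal c \<le> emeasure \<mu> (ball (z j) (R / 4))"
          by (rule lower)
        also have "\<dots> \<le> emeasure \<mu> ?B"
          using *(3) pos by (intro emeasure_mono subset_ball) auto
        finally show "ennreal c \<le> emeasure \<mu> ?B" .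
      qed (use p in auto)
      also have "\<dots> = ennreal (K * (2 * \<rho>) * (a j / c) powr q)"
        using a(2)[OF that] pos *(3) by (simp add: divide_ennreal ennreal_powr_def q_def ennreal_mult)
      finally show ?thesis .
    qed
    have "(\<integral>\<^sup>+t\<in>ball x r. g t \<partial>lborel) = (\<Sum>j<n. \<integral>\<^sup>+t\<in>J j. g t \<partial>lborel)"
      unfolding split sum_distrib_left by (intro nn_integral_sum) measurable
    also have "\<dots> \<le> (\<Sum>j<n. ennreal (K * (2 * \<rho>) * (a j / c) powr q))"
      using piece by (intro sum_mono) auto
    also have "\<dots> = ennreal (K * (2 * \<rho>) * (\<Sum>j<n. (a j / c) powr q))"
      using pos *(3) by (simp add: sum_distrib_left)
    also have "\<dots> \<le> ennreal (K * (2 * \<rho>) * (2 * card {..<n} * ((\<Sum>j<n. a j / c) / card {..<n}) powr q))"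
      using pos *(1,3) q a(2) by (intro ennreal_leI mult_left_mono sum_powr_le) auto
    also have "\<dots> = ennreal (4 * K * r * ((\<Sum>j<n. a j) / (n * c)) powr q)"
      unfolding *(2)[symmetric] by (simp add: sum_divide_distrib[symmetric] field_simps)
    also have "\<dots> = ennreal (4 * K * r) * ennreal_powr (?A / ennreal (n * c)) q"
      unfolding A_eq using pos r0 a_sum *(1)
      by (subst divide_ennreal) (simp_all add: ennreal_powr_def ennreal_mult)
    also have "\<dots> \<le> ennreal (4 * K * r) * ennreal_powr (ennreal (C / c) * (?A / emeasure \<mu> (ball x r))) q"
    proof (intro mult_left_mono ennreal_powr_mono)
      \<comment> \<open>The pieces have produced n c in the denominator, whereas the mass of the
        ball is only known to be at most n C; the exchange costs C/c.\<close>
      have "emeasure \<mu> (ball x r) = (\<Sum>j<n. emeasure \<mu> (J j))"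
        unfolding *(7)[symmetric] using * sets by (intro sum_emeasure[symmetric]) auto
      also have "\<dots> \<le> (\<Sum>j<n. ennreal C)"
      proof (intro sum_mono)
        fix j
        have "emeasure \<mu> (J j) \<le> emeasure \<mu> (ball (z j) R)"
          using *(9)[of j] *(4) subset_ball[of "2 * \<rho>" R "z j"] by (intro emeasure_mono) auto
        then show "emeasure \<mu> (J j) \<le> ennreal C"
          using upper[of "z j"] by (rule order_trans)
      qed
      also have "\<dots> = ennreal (n * C)"
        using pos by (simp add: ennreal_mult ennreal_of_nat_eq_real_of_nat)
      finally have "?A / ennreal (n * C) \<le> ?A / emeasure \<mu> (ball x r)"
        by (rule ennreal_divide_antimono)
      moreover have "?A / ennreal (n * c) = ennreal (C / c) * (?A / ennreal (n * C))"
        unfolding A_eq using pos *(1) a_sum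
        by (simp add: divide_ennreal flip: ennreal_mult)
      ultimately show "?A / ennreal (n * c) \<le> ennreal (C / c) * (?A / emeasure \<mu> (ball x r))"
        by (simp add: mult_left_mono)
    qed (use q in auto)
    finally show ?thesis .
  qed
  also have "\<dots> \<le> ennreal (4 * K * r) * (ennreal (C / c) * ennreal_powr (?A / emeasure \<mu> (ball x r)) q)"
    using pos q by (intro mult_left_mono ennreal_powr_cmult_le) auto
  also have "\<dots> = ennreal (4 * K * (C / c) * r) * ennreal_powr (?A / emeasure \<mu> (ball x r)) (1 / p)"
  proof -
    have "ennreal (4 * K * (C / c) * r) = ennreal (4 * K * r) * ennreal (C / c)"
      using pos r0 by (subst ennreal_mult[symmetric]) (auto simp: mult_ac)
    then show ?thesis
      by (simp add: q_def mult.assoc)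
  qed
  finally show "(\<integral>\<^sup>+t\<in>ball x r. g t \<partial>lborel) \<le>
      ennreal (4 * K * (C / c) * r) * ennreal_powr (?A / emeasure \<mu> (ball x r)) (1 / p)" .
qed

lemma muckenhoupt_all:
  assumes "0 < r"
  shows "muckenhoupt_ball p (4 * K * (C / c)) \<mu> x r"
proof (cases "r \<le> R")
  case True
  have "K * r \<le> 4 * K * (C / c) * r"
    using pos assms by (simp add: field_simps)
  then have "ennreal (K * r) * y \<le> ennreal (4 * K * (C / c) * r) * y" for y
    by (intro mult_right_mono[OF ennreal_leI]) auto
  then show ?thesis
    using muckenhoupt[OF assms True, of x] unfolding muckenhoupt_ball_def
    by (meson order_trans)
qed (use muckenhoupt_large pos in auto)

lemma globally_admissible: "globally_admissible p \<mu>"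
  unfolding globally_admissible_def
proof (intro exI conjI allI impI)
  show "doubling_within_with (D + 4 * C / c) \<mu> (ball x\<^sub>0 r\<^sub>0)" for x\<^sub>0 r\<^sub>0
    unfolding doubling_within_with_def using doubling_all by blast
  show "poincare_within_with p (4 * K * (C / c)) 1 \<mu> (ball x\<^sub>0 r\<^sub>0)" for x\<^sub>0 r\<^sub>0
    unfolding poincare_within_with_def mult_1_left
    by (intro allI impI poincare_of_muckenhoupt_ball sets space ball_pos_finite muckenhoupt_all)
  show "0 < D + 4 * C / c" "0 < 4 * K * (C / c)"
    using pos by (auto intro!: add_pos_nonneg)
qed simp

end


section \<open>The reflected measure on small scales\<close>

text \<open>The inverse of \<open>fold_map M k\<close>. It turns images under folding into
  preimages, which makes their measurability immediate.\<close>

definition unfold_map :: "real \<Rightarrow> int \<Rightarrow> real \<Rightarrow> real" where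
  "unfold_map M k y = 2 * of_int k * M + (-1) powi k * y"

lemma sign_square [simp]: "((-1) powi k :: real) * (-1) powi k = 1"
  by (simp flip: power_int_mult_distrib)

lemma abs_sign [simp]: "\<bar>(-1) powi k :: real\<bar> = 1"
  by (simp add: power_int_abs)

lemma fold_unfold [simp]: "fold_map M k (unfold_map M k y) = y"
  by (simp add: fold_map_def unfold_map_def flip: mult.assoc)

lemma unfold_fold [simp]: "unfold_map M k (fold_map M k x) = x"
  by (simp add: fold_map_def unfold_map_def flip: mult.assoc)

lemma fold_map_image: "fold_map M k ` A = unfold_map M k -` A"
  by (force intro: image_eqI[of _ _ "unfold_map M k y" for y])

lemma fold_map_isometry: "\<bar>fold_map M k x - fold_map M k y\<bar> = \<bar>x - y\<bar>"
proof -
  have "fold_map M k x - fold_map M k y = (-1) powi k * (x - y)"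
    by (simp add: fold_map_def algebra_simps)
  then show ?thesis
    by (simp add: abs_mult)
qed

lemma fold_map_measurable [measurable]: "fold_map M k \<in> borel_measurable borel"
  unfolding fold_map_def[abs_def] by measurable

lemma unfold_map_measurable [measurable]: "unfold_map M k \<in> borel_measurable borel"
  unfolding unfold_map_def[abs_def] by measurable

lemma fold_map_image_borel: "A \<in> sets borel \<Longrightarrow> fold_map M k ` A \<in> sets borel"
  using measurable_sets[of "unfold_map M k" borel borel A] by (simp add: fold_map_image)

lemma period_cell_borel [measurable, simp]: "period_cell M k \<in> sets borel"
  by (simp add: period_cell_def)

lemma period_cell_iff: "x \<in> period_cell M k \<longleftrightarrow> - M \<le> x - 2 * of_int k * M \<and> x - 2 * of_int k * M < M"
  by (auto simp: period_cell_def algebra_simps)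

text \<open>An explicit formula for the index of the cell of x, from which both covering and
  disjointness of the cells follow.\<close>

lemma period_cell_iff_floor:
  assumes "0 < M"
  shows "x \<in> period_cell M k \<longleftrightarrow> \<lfloor>(x + M) / (2 * M)\<rfloor> = k"
  using assms by (auto simp: period_cell_def floor_eq_iff field_simps)

lemma abs_fold_map_le:
  assumes "x \<in> period_cell M k"
  shows "\<bar>fold_map M k x\<bar> \<le> M"
proof -
  have "\<bar>fold_map M k x\<bar> = \<bar>x - 2 * of_int k * M\<bar>"
    by (simp add: fold_map_def abs_mult)
  then show ?thesis
    using assms by (auto simp: period_cell_iff)
qed

lemma unfold_map_in_period_cell:
  assumes "\<bar>y\<bar> < M"
  shows "unfold_map M k y \<in> period_cell M k"
proof -
  have "\<bar>unfold_map M k y - 2 * of_int k * M\<bar> < M"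
    using assms by (simp add: unfold_map_def abs_mult)
  then show ?thesis
    unfolding period_cell_iff by linarith
qed

text \<open>Let b be the common endpoint of the two cells. The folds carry opposite signs, so the
  images differ by (x - b) + (t - b) up to sign; these summands have opposite signs, whereas in x -
  t their sizes add.\<close>

lemma fold_map_adjacent_cells:
  assumes "x \<in> period_cell M k" "t \<in> period_cell M (k + 1)"
  shows "\<bar>fold_map M k x - fold_map M (k + 1) t\<bar> \<le> \<bar>x - t\<bar>"
proof -
  have sgn: "(-1) powi (k + 1) = - ((-1) powi k :: real)"
    by (simp add: power_int_add)
  define b where "b = (2 * of_int k + 1) * M"
  have "fold_map M k x - fold_map M (k + 1) t = (-1) powi k * ((x - b) + (t - b))"
    unfolding fold_map_def sgn b_def by (simp add: algebra_simps)
  then have "\<bar>fold_map M k x - fold_map M (k + 1) t\<bar> = \<bar>(x - b) + (t - b)\<bar>"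
    by (simp add: abs_mult)
  also have "\<dots> \<le> \<bar>x - t\<bar>"
    using assms by (auto simp: period_cell_def b_def algebra_simps)
  finally show ?thesis .
qed

lemma fold_map_nearby_cells:
  assumes "x \<in> period_cell M k" "t \<in> period_cell M j" "j \<in> {k - 1, k, k + 1}"
  shows "\<bar>fold_map M k x - fold_map M j t\<bar> \<le> \<bar>x - t\<bar>"
proof -
  consider "j = k" | "j = k + 1" | "k = j + 1"
    using assms(3) by auto
  then show ?thesis
  proof cases
    case 1
    then show ?thesis
      by (simp add: fold_map_isometry)
  next
    case 2
    then show ?thesis
      using fold_map_adjacent_cells assms by blast
  next
    case 3
    then show ?thesis
      using fold_map_adjacent_cells[of t M j x] assms by (simp add: abs_minus_commute)
  qed
qed

lemma ball_subset_nearby_cells: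
  assumes "0 < M" "x \<in> period_cell M k" "r \<le> M"
  shows "ball x r \<subseteq> (\<Union>j\<in>{k - 1, k, k + 1}. period_cell M j)"
proof
  fix t assume "t \<in> ball x r"
  then have "\<bar>x - t\<bar> < M"
    using assms by (simp add: dist_real_def)
  then show "t \<in> (\<Union>j\<in>{k - 1, k, k + 1}. period_cell M j)"
    using assms(2) by (auto simp: period_cell_iff algebra_simps not_le not_less)
qed

lemma fold_map_ball_subset:
  assumes "x \<in> period_cell M k" "j \<in> {k - 1, k, k + 1}"
  shows "fold_map M j ` (ball x r \<inter> period_cell M j) \<subseteq> ball (fold_map M k x) r"
  using fold_map_nearby_cells[OF assms(1) _ assms(2)] by (fastforce simp: dist_real_def)

lemma ball_subset_fold_map_ball:
  assumes "\<bar>z\<bar> + s \<le> M" "\<bar>z - fold_map M k x\<bar> + s \<le> r"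
  shows "ball z s \<subseteq> fold_map M k ` (ball x r \<inter> period_cell M k)"
proof
  fix w assume "w \<in> ball z s"
  then have "\<bar>z - w\<bar> < s"
    by (simp add: dist_real_def)
  with assms have w: "\<bar>w\<bar> < M" "\<bar>fold_map M k x - w\<bar> < r"
    by linarith+
  have "\<bar>x - unfold_map M k w\<bar> = \<bar>fold_map M k x - w\<bar>"
    using fold_map_isometry[of M k x "unfold_map M k w"] by simp
  with w show "w \<in> fold_map M k ` (ball x r \<inter> period_cell M k)"
    by (intro image_eqI[of _ _ "unfold_map M k w"]) (auto simp: dist_real_def unfold_map_in_period_cell)
qed

text \<open>Near the edge of its cell only part of \<open>ball x r\<close> stays inside. Moving the
  centre from the folded point by r/2 towards 0, or past it by at most r/2, leaves room for a ball
  of half the radius, since r <= M.\<close>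

lemma ball_subset_fold_map_ball_exists:
  assumes "x \<in> period_cell M k" "0 < r" "r \<le> M"
  obtains z where "\<bar>z\<bar> \<le> M" "\<bar>z - fold_map M k x\<bar> = r / 2"
    "ball z (r / 2) \<subseteq> fold_map M k ` (ball x r \<inter> period_cell M k)"
proof -
  define y where "y = fold_map M k x"
  have y: "\<bar>y\<bar> \<le> M"
    using abs_fold_map_le[OF assms(1)] by (simp add: y_def)
  define z where "z = (if y \<ge> 0 then y - r / 2 else y + r / 2)"
  have "\<bar>z\<bar> + r / 2 \<le> M" "\<bar>z - y\<bar> = r / 2"
    using y assms by (auto simp: z_def)
  then show thesis
    using that[of z] ball_subset_fold_map_ball[of z "r / 2" M k x r] assms by (simp add: y_def)
qed

section \<open>Masses and integrals of the reflected measure, cell by cell\<close>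

locale reflection =
  fixes \<mu> :: "real measure" and M :: real
  assumes \<mu>: "measure_on_R \<mu>" and M: "0 < M"
begin

abbreviation "\<mu>' \<equiv> reflected_measure M \<mu>"

lemma cell_exists: obtains k where "x \<in> period_cell M k"
  using period_cell_iff_floor[OF M] by blast

lemma cells_disjoint: "x \<in> period_cell M k \<Longrightarrow> x \<in> period_cell M j \<Longrightarrow> k = j"
  by (simp add: period_cell_iff_floor[OF M])

lemma space_reflected: "space \<mu>' = UNIV"
  by (simp add: reflected_measure_def space_measure_of_conv)

lemma borel_sets_reflected:
  assumes "A \<in> sets borel"
  shows "A \<in> sets \<mu>'"
proof -
  have "fold_map M k ` (A \<inter> period_cell M k) \<in> sets \<mu>" for k
    by (intro measure_on_R_borel_sets[OF \<mu>] fold_map_image_borel sets.Int assms) simp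
  then show ?thesis
    by (simp add: sets_reflected_measure[OF \<mu>] reflected_sets_def)
qed

lemma borel_measurable_reflected:
  assumes "f \<in> borel \<rightarrow>\<^sub>M N"
  shows "f \<in> \<mu>' \<rightarrow>\<^sub>M N"
proof (rule measurableI)
  show "f x \<in> space N" for x
    using measurable_space[OF assms] by simp
  show "f -` A \<inter> space \<mu>' \<in> sets \<mu>'" if "A \<in> sets N" for A
    using borel_sets_reflected[OF measurable_sets[OF assms that]] by (simp add: space_reflected)
qed

lemma emeasure_cell:
  assumes "A \<in> sets \<mu>'" "A \<subseteq> period_cell M k"
  shows "emeasure \<mu>' A = emeasure \<mu> (fold_map M k ` A)"
proof -
  have "A \<inter> period_cell M j = {}" if "j \<noteq> k" for j
    using assms(2) cells_disjoint[of _ j k] that by blast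
  then have "(\<Sum>\<^sub>\<infinity>j. emeasure \<mu> (fold_map M j ` (A \<inter> period_cell M j))) =
      (\<Sum>\<^sub>\<infinity>j\<in>{k}. emeasure \<mu> (fold_map M j ` (A \<inter> period_cell M j)))"
    by (intro infsum_cong_neutral) auto
  also have "A \<inter> period_cell M k = A"
    using assms(2) by blast
  then have "(\<Sum>\<^sub>\<infinity>j\<in>{k}. emeasure \<mu> (fold_map M j ` (A \<inter> period_cell M j))) = emeasure \<mu> (fold_map M k ` A)"
    by simp
  finally show ?thesis
    by (simp add: emeasure_reflected_measure[OF \<mu> assms(1)])
qed

text \<open>On one cell the reflected measure is the pushforward of \<open>\<mu>\<close> under
  unfolding. Pushing it forward under the identity restricts it to the Borel sets, where the two
  measures can be compared.\<close>

lemma nn_integral_cell: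
  assumes h[measurable]: "h \<in> borel_measurable borel"
  shows "(\<integral>\<^sup>+x\<in>period_cell M k. h x \<partial>\<mu>') =
    (\<integral>\<^sup>+y. h (unfold_map M k y) * indicator (period_cell M k) (unfold_map M k y) \<partial>\<mu>)"
proof -
  let ?I = "indicator (period_cell M k) :: real \<Rightarrow> ennreal"
  have [measurable]: "(\<lambda>x. x) \<in> \<mu>' \<rightarrow>\<^sub>M borel" "unfold_map M k \<in> \<mu> \<rightarrow>\<^sub>M borel"
    by (auto intro: borel_measurable_reflected measure_on_R_borel_measurable[OF \<mu>])
  have "density (distr \<mu>' borel (\<lambda>x. x)) ?I = density (distr \<mu> borel (unfold_map M k)) ?I"
  proof (rule measure_eqI)
    fix A assume "A \<in> sets (density (distr \<mu>' borel (\<lambda>x. x)) ?I)"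
    then have A[measurable]: "A \<in> sets borel"
      by simp
    then have "A \<inter> period_cell M k \<in> sets borel"
      by simp
    have "emeasure (density (distr \<mu>' borel (\<lambda>x. x)) ?I) A =
        emeasure (distr \<mu>' borel (\<lambda>x. x)) (A \<inter> period_cell M k)"
      by (simp add: emeasure_density Int_commute flip: indicator_inter_arith)
    also have "\<dots> = emeasure \<mu>' (A \<inter> period_cell M k)"
      by (simp add: emeasure_distr space_reflected)
    also have "\<dots> = emeasure \<mu> (unfold_map M k -` (A \<inter> period_cell M k))"
      by (subst emeasure_cell) (auto intro!: borel_sets_reflected simp: fold_map_image)
    also have "\<dots> = emeasure (distr \<mu> borel (unfold_map M k)) (A \<inter> period_cell M k)"
      by (simp add: emeasure_distr measure_on_R_space[OF \<mu>])
    also have "\<dots> = emeasure (density (distr \<mu> borel (unfold_map M k)) ?I) A"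
      by (simp add: emeasure_density Int_commute flip: indicator_inter_arith)
    finally show "emeasure (density (distr \<mu>' borel (\<lambda>x. x)) ?I) A =
        emeasure (density (distr \<mu> borel (unfold_map M k)) ?I) A" .
  qed simp
  then have "(\<integral>\<^sup>+x. h x \<partial>density (distr \<mu>' borel (\<lambda>x. x)) ?I) =
      (\<integral>\<^sup>+x. h x \<partial>density (distr \<mu> borel (unfold_map M k)) ?I)"
    by simp
  then show ?thesis
    by (simp add: nn_integral_density nn_integral_distr mult.commute)
qed

text \<open>The ball meets at most three cells, and its part in each of them folds into the ball of
  the same radius around the folded centre.\<close>

lemma emeasure_ball_le:
  assumes "x \<in> period_cell M k" "r \<le> M"
  shows "emeasure \<mu>' (ball x r) \<le> 3 * emeasure \<mu> (ball (fold_map M k x) r)"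
proof -
  let ?F = "{k - 1, k, k + 1}"
  have *: "ball x r \<inter> period_cell M j \<in> sets borel" for j
    by simp
  have "emeasure \<mu>' (ball x r) \<le> emeasure \<mu>' (\<Union>j\<in>?F. ball x r \<inter> period_cell M j)"
    using ball_subset_nearby_cells[OF M assms] *
    by (intro emeasure_mono borel_sets_reflected) blast+
  also have "\<dots> \<le> (\<Sum>j\<in>?F. emeasure \<mu>' (ball x r \<inter> period_cell M j))"
    using *[THEN borel_sets_reflected] by (intro emeasure_subadditive_finite) auto
  also have "\<dots> \<le> (\<Sum>j\<in>?F. emeasure \<mu> (ball (fold_map M k x) r))"
  proof (intro sum_mono)
    fix j assume "j \<in> ?F"
    have "emeasure \<mu>' (ball x r \<inter> period_cell M j) = emeasure \<mu> (fold_map M j ` (ball x r \<inter> period_cell M j))"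
      by (intro emeasure_cell borel_sets_reflected) auto
    also have "\<dots> \<le> emeasure \<mu> (ball (fold_map M k x) r)"
      using fold_map_ball_subset[OF assms(1) \<open>j \<in> ?F\<close>]
      by (intro emeasure_mono measure_on_R_borel_sets[OF \<mu>]) auto
    finally show "emeasure \<mu>' (ball x r \<inter> period_cell M j) \<le> emeasure \<mu> (ball (fold_map M k x) r)" .
  qed
  also have "\<dots> = 3 * emeasure \<mu> (ball (fold_map M k x) r)"
    by simp
  finally show ?thesis .
qed

lemma emeasure_ball_ge:
  assumes "ball z s \<subseteq> fold_map M k ` (ball x r \<inter> period_cell M k)"
  shows "emeasure \<mu> (ball z s) \<le> emeasure \<mu>' (ball x r)"
proof -
  have "emeasure \<mu> (ball z s) \<le> emeasure \<mu> (fold_map M k ` (ball x r \<inter> period_cell M k))"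
    using assms by (intro emeasure_mono measure_on_R_borel_sets[OF \<mu>] fold_map_image_borel) auto
  also have "\<dots> = emeasure \<mu>' (ball x r \<inter> period_cell M k)"
    by (intro emeasure_cell[symmetric] borel_sets_reflected) auto
  also have "\<dots> \<le> emeasure \<mu>' (ball x r)"
    by (intro emeasure_mono borel_sets_reflected) auto
  finally show ?thesis .
qed

text \<open>Of the factor 9, one 3 counts the cells that the ball meets; the other compares the
  masses of \<open>ball x r\<close> and \<open>ball y r\<close> and is taken out of the power
  1/p.\<close>

lemma muckenhoupt_ball_reflected:
  assumes "1 \<le> p" "0 < K" "0 < r" "r \<le> M" "x \<in> period_cell M k"
    and muck: "muckenhoupt_ball p K \<mu> (fold_map M k x) r"
  shows "muckenhoupt_ball p (9 * K) \<mu>' x r"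
  unfolding muckenhoupt_ball_def
proof
  fix g :: "real \<Rightarrow> ennreal" assume g[measurable]: "g \<in> borel_measurable borel"
  define y where "y = fold_map M k x"
  let ?F = "{k - 1, k, k + 1}"
  let ?A = "\<integral>\<^sup>+t\<in>ball x r. ennreal_powr (g t) p \<partial>\<mu>'"
  let ?E = "\<lambda>j. ball x r \<inter> period_cell M j"
  have [measurable]: "ball x r \<in> sets borel" "?E j \<in> sets borel" for j
    by auto
  have A_le: "?A / emeasure \<mu> (ball y r) \<le> ennreal 3 * (?A / emeasure \<mu>' (ball x r))"
  proof -
    have "?A / emeasure \<mu> (ball y r) = ?A * 3 / (emeasure \<mu> (ball y r) * 3)"
      by (rule divide_mult_eq[symmetric]) auto
    also have "\<dots> = 3 * (?A / (3 * emeasure \<mu> (ball y r)))"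
      by (simp add: ennreal_times_divide mult.commute)
    also have "\<dots> \<le> 3 * (?A / emeasure \<mu>' (ball x r))"
      using emeasure_ball_le[of x k r] assms
      by (intro mult_left_mono ennreal_divide_antimono) (auto simp: y_def)
    finally show ?thesis
      by simp
  qed
  have piece: "(\<integral>\<^sup>+t\<in>?E j. g t \<partial>lborel) \<le>
      ennreal (K * r) * (ennreal 3 * ennreal_powr (?A / emeasure \<mu>' (ball x r)) (1 / p))"
    if "j \<in> ?F" for j
  proof -
    define f where "f = (\<lambda>w. g (unfold_map M j w) * indicator (?E j) (unfold_map M j w))"
    have f[measurable]: "f \<in> borel_measurable borel"
      unfolding f_def by measurable
    \<comment> \<open>The part of the ball in cell j folds into \<open>ball y r\<close>, so f is
      supported there and its integrals may be taken over the whole line.\<close>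
    have f_supp: "f w * indicator (ball y r) w = f w" for w
    proof (cases "unfold_map M j w \<in> ?E j")
      case True
      then have "w \<in> fold_map M j ` ?E j"
        by (simp add: fold_map_image)
      then have "w \<in> ball y r"
        using fold_map_ball_subset[OF assms(5) that, of r] by (auto simp: y_def)
      then show ?thesis
        by simp
    qed (simp add: f_def)
    \<comment> \<open>Unfolding is affine with slope 1 or -1, so it preserves Lebesgue
      measure.\<close>
    have "(\<integral>\<^sup>+t\<in>?E j. g t \<partial>lborel) = (\<integral>\<^sup>+w. f w \<partial>lborel)"
      using nn_integral_real_affine[of "\<lambda>t. g t * indicator (?E j) t" "(-1) powi j" "2 * of_int j * M"]
      by (simp add: f_def unfold_map_def)
    also have "\<dots> = (\<integral>\<^sup>+w\<in>ball y r. f w \<partial>lborel)"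
      by (simp add: f_supp)
    also have "\<dots> \<le> ennreal (K * r) *
        ennreal_powr ((\<integral>\<^sup>+w\<in>ball y r. ennreal_powr (f w) p \<partial>\<mu>) / emeasure \<mu> (ball y r)) (1 / p)"
      using muck f unfolding muckenhoupt_ball_def y_def by blast
    also have "\<dots> \<le> ennreal (K * r) *
        ennreal_powr (ennreal 3 * (?A / emeasure \<mu>' (ball x r))) (1 / p)"
    proof (intro mult_left_mono ennreal_powr_mono)
      have "(\<integral>\<^sup>+w\<in>ball y r. ennreal_powr (f w) p \<partial>\<mu>) = (\<integral>\<^sup>+w. ennreal_powr (f w) p \<partial>\<mu>)"
        by (simp add: f_supp flip: ennreal_powr_indicator)
      also have "\<dots> = (\<integral>\<^sup>+w. (ennreal_powr (g (unfold_map M j w)) p * indicator (ball x r) (unfold_map M j w)) *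
          indicator (period_cell M j) (unfold_map M j w) \<partial>\<mu>)"
        by (intro nn_integral_cong) (simp add: f_def indicator_def)
      also have "\<dots> = (\<integral>\<^sup>+t\<in>period_cell M j. ennreal_powr (g t) p * indicator (ball x r) t \<partial>\<mu>')"
        by (subst nn_integral_cell) auto
      also have "\<dots> \<le> ?A"
        by (intro nn_integral_mono) (simp add: indicator_def)
      finally show "(\<integral>\<^sup>+w\<in>ball y r. ennreal_powr (f w) p \<partial>\<mu>) / emeasure \<mu> (ball y r) \<le>
          ennreal 3 * (?A / emeasure \<mu>' (ball x r))"
        using A_le by (blast intro: order_trans divide_right_mono_ennreal)
    qed (use \<open>1 \<le> p\<close> in auto)
    also have "\<dots> \<le> ennreal (K * r) * (ennreal 3 * ennreal_powr (?A / emeasure \<mu>' (ball x r)) (1 / p))"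
      using \<open>1 \<le> p\<close> by (intro mult_left_mono ennreal_powr_cmult_le) auto
    finally show ?thesis .
  qed
  have "(\<integral>\<^sup>+t\<in>ball x r. g t \<partial>lborel) \<le> (\<integral>\<^sup>+t. (\<Sum>j\<in>?F. g t * indicator (?E j) t) \<partial>lborel)"
  proof (intro nn_integral_mono)
    fix t
    show "g t * indicator (ball x r) t \<le> (\<Sum>j\<in>?F. g t * indicator (?E j) t)"
    proof (cases "t \<in> ball x r")
      case True
      then obtain j where "j \<in> ?F" "t \<in> period_cell M j"
        using ball_subset_nearby_cells[OF M assms(5,4)] by blast
      with True show ?thesis
        using member_le_sum[of j ?F "\<lambda>j. g t * indicator (?E j) t"] by simp
    qed simp
  qed
  also have "\<dots> = (\<Sum>j\<in>?F. \<integral>\<^sup>+t\<in>?E j. g t \<partial>lborel)"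
    by (rule nn_integral_sum) measurable
  also have "\<dots> \<le> (\<Sum>j\<in>?F. ennreal (K * r) * (ennreal 3 * ennreal_powr (?A / emeasure \<mu>' (ball x r)) (1 / p)))"
    by (intro sum_mono piece)
  also have "\<dots> = ennreal 3 * (ennreal (K * r) * (ennreal 3 * ennreal_powr (?A / emeasure \<mu>' (ball x r)) (1 / p)))"
    by simp
  also have "\<dots> = ennreal (9 * K * r) * ennreal_powr (?A / emeasure \<mu>' (ball x r)) (1 / p)"
  proof -
    have "ennreal (9 * K * r) = ennreal (3 * ((K * r) * 3))"
      by (simp add: mult_ac)
    also have "\<dots> = ennreal 3 * ennreal ((K * r) * 3)"
      using assms by (intro ennreal_mult) auto
    also have "ennreal ((K * r) * 3) = ennreal (K * r) * ennreal 3"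
      using assms by (intro ennreal_mult) auto
    finally show ?thesis
      by (simp only: mult.assoc)
  qed
  finally show "(\<integral>\<^sup>+t\<in>ball x r. g t \<partial>lborel) \<le>
      ennreal (9 * K * r) * ennreal_powr (?A / emeasure \<mu>' (ball x r)) (1 / p)" .
qed

end

text \<open>By total boundedness, finitely many balls of radius \<open>\<rho> / 2\<close> cover the
  centres, and each \<open>ball z \<rho>\<close> contains one of them.\<close>

lemma emeasure_ball_bounded_below:
  assumes \<mu>: "measure_on_R \<mu>" and "0 < \<rho>"
  obtains c where "0 < c" "\<And>z. \<bar>z\<bar> \<le> M \<Longrightarrow> ennreal c \<le> emeasure \<mu> (ball z \<rho>)"
proof -
  have "compact {- M..M}"
    by simp
  then obtain T where T: "finite T" "{- M..M} \<subseteq> (\<Union>w\<in>T. ball w (\<rho> / 2))"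
    using \<open>0 < \<rho>\<close> unfolding compact_eq_totally_bounded by (meson half_gt_zero)
  \<comment> \<open>The extra element 1 keeps the minimum well defined when T is empty.\<close>
  define c where "c = Min (insert 1 ((\<lambda>w. measure \<mu> (ball w (\<rho> / 2))) ` T))"
  have "0 < measure \<mu> (ball w (\<rho> / 2))" for w
    using measure_on_R_ball[OF \<mu>, of "\<rho> / 2" w] \<open>0 < \<rho>\<close>
    by (simp add: measure_def enn2real_positive_iff less_top zero_less_iff_neq_zero)
  then have "0 < c"
    using T by (auto simp: c_def)
  moreover have "ennreal c \<le> emeasure \<mu> (ball z \<rho>)" if "\<bar>z\<bar> \<le> M" for z
  proof -
    have "z \<in> {- M..M}"
      using that by auto
    then obtain w where w: "w \<in> T" "z \<in> ball w (\<rho> / 2)"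
      using T by blast
    have "c \<le> measure \<mu> (ball w (\<rho> / 2))"
      unfolding c_def using T w by (intro Min_le) auto
    then have "ennreal c \<le> ennreal (measure \<mu> (ball w (\<rho> / 2)))"
      by (rule ennreal_leI)
    also have "\<dots> = emeasure \<mu> (ball w (\<rho> / 2))"
      using measure_on_R_ball[OF \<mu>, of "\<rho> / 2" w] \<open>0 < \<rho>\<close> by (simp add: emeasure_eq_ennreal_measure)
    also have "\<dots> \<le> emeasure \<mu> (ball z \<rho>)"
    proof (rule emeasure_mono)
      show "ball w (\<rho> / 2) \<subseteq> ball z \<rho>"
      proof
        fix t assume "t \<in> ball w (\<rho> / 2)"
        then show "t \<in> ball z \<rho>"
          using w dist_triangle[of z t w] by (simp add: dist_commute)
      qed
    qed (simp add: measure_on_R_borel_sets[OF \<mu>])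
    finally show ?thesis .
  qed
  ultimately show thesis
    by (rule that)
qed

section \<open>Completeness of the reflected measure, and its small scale estimates\<close>

context reflection
begin

text \<open>Every reflected-measurable set is, cell by cell, a Borel set up to a subset of a Borel
  null set. The cells being countably many, this passes to the union.\<close>

lemma reflected_completion: "\<exists>\<nu>. sets \<nu> = sets borel \<and> \<mu>' = completion \<nu>"
proof (intro exI conjI)
  obtain \<nu>0 where \<nu>0: "sets \<nu>0 = sets borel" "\<mu> = completion \<nu>0"
    using \<mu> unfolding measure_on_R_def by blast
  define \<nu> where "\<nu> = distr \<mu>' borel (\<lambda>x. x)"
  show sets_\<nu>: "sets \<nu> = sets borel"
    by (simp add: \<nu>_def)
  have \<nu>: "emeasure \<nu> A = emeasure \<mu>' A" if "A \<in> sets borel" for A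
    using that borel_measurable_reflected[of "\<lambda>x. x" borel]
    by (simp add: \<nu>_def emeasure_distr space_reflected)
  have null_cell: "fold_map M k -` N \<inter> period_cell M k \<in> null_sets \<nu>" if N: "N \<in> null_sets \<nu>0" for N k
  proof -
    have N': "N \<in> sets borel"
      using N \<nu>0 by auto
    have *: "fold_map M k -` N \<inter> period_cell M k \<in> sets borel"
      using measurable_sets[OF fold_map_measurable N', of M k] by auto
    have "emeasure \<mu>' (fold_map M k -` N \<inter> period_cell M k) =
        emeasure \<mu> (fold_map M k ` (fold_map M k -` N \<inter> period_cell M k))"
      by (intro emeasure_cell borel_sets_reflected *) auto
    also have "\<dots> \<le> emeasure \<mu> N"
      by (intro emeasure_mono measure_on_R_borel_sets[OF \<mu>] N') auto
    also have "\<dots> = 0"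
      using null_sets_completionI[OF N] \<nu>0(2) by auto
    finally show ?thesis
      using * by (intro null_setsI) (simp_all add: \<nu> sets_\<nu>)
  qed
  have sub1: "A \<in> sets (completion \<nu>)" if A: "A \<in> sets \<mu>'" for A
  proof -
    have "\<exists>S N N'. fold_map M k ` (A \<inter> period_cell M k) = S \<union> N \<and> N \<subseteq> N' \<and> N' \<in> null_sets \<nu>0 \<and> S \<in> sets \<nu>0" for k
    proof -
      have "fold_map M k ` (A \<inter> period_cell M k) \<in> sets (completion \<nu>0)"
        using A unfolding sets_reflected_measure[OF \<mu>] reflected_sets_def \<nu>0(2)[symmetric] by simp
      then show ?thesis
        by (rule sets_completionE) blast
    qed
    then obtain S N N' where *: "\<And>k. fold_map M k ` (A \<inter> period_cell M k) = S k \<union> N k"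
      "\<And>k. N k \<subseteq> N' k" "\<And>k. N' k \<in> null_sets \<nu>0" "\<And>k. S k \<in> sets \<nu>0"
      by metis
    \<comment> \<open>S k and N k lie in the folded cell, but N' k need not; cutting with the cell
      prepares the enlargement of N k to N' k.\<close>
    have cell: "A \<inter> period_cell M k = (fold_map M k -` S k) \<union> (fold_map M k -` N k \<inter> period_cell M k)" for k
    proof -
      have "A \<inter> period_cell M k = fold_map M k -` (fold_map M k ` (A \<inter> period_cell M k))"
        by (simp add: inj_vimage_image_eq[OF inj_fold_map])
      then show ?thesis
        unfolding *(1) by blast
    qed
    have "A = (\<Union>k. fold_map M k -` S k) \<union> (\<Union>k. fold_map M k -` N k \<inter> period_cell M k)"
    proof -
      have "A = (\<Union>k. A \<inter> period_cell M k)"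
        using cell_exists by blast
      also have "\<dots> = (\<Union>k. fold_map M k -` S k \<union> (fold_map M k -` N k \<inter> period_cell M k))"
        by (simp only: cell)
      finally show ?thesis
        by (simp only: UN_Un_distrib)
    qed
    moreover have "(\<Union>k. fold_map M k -` N k \<inter> period_cell M k) \<subseteq> (\<Union>k. fold_map M k -` N' k \<inter> period_cell M k)"
      using *(2) by blast
    moreover have "(\<Union>k. fold_map M k -` N' k \<inter> period_cell M k) \<in> null_sets \<nu>"
      using null_cell *(3) by (intro null_sets_UN') auto
    moreover have "(\<Union>k. fold_map M k -` S k) \<in> sets \<nu>"
    proof (intro sets.countable_UN'')
      show "fold_map M k -` S k \<in> sets \<nu>" for k
        using measurable_sets[OF fold_map_measurable, of "S k" M k] *(4)[of k] by (simp add: sets_\<nu> \<nu>0)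
    qed auto
    ultimately show ?thesis
      by (rule sets_completionI)
  qed
  \<comment> \<open>The pieces of N fold into subsets of null Borel sets, which are measurable
    because \<open>\<mu>\<close> is complete.\<close>
  have null_sub: "N \<in> null_sets \<mu>'" if N: "N \<subseteq> N'" "N' \<in> null_sets \<nu>" for N N'
  proof -
    have N': "N' \<in> sets borel" "N' \<in> sets \<mu>'" "emeasure \<mu>' N' = 0"
      using N(2) \<nu>[of N'] sets_\<nu> borel_sets_reflected by (auto simp: null_sets_def)
    have "fold_map M k ` (N \<inter> period_cell M k) \<in> sets \<mu>" for k
    proof -
      have *: "N' \<inter> period_cell M k \<in> sets borel"
        using N' by simp
      have "emeasure \<mu> (fold_map M k ` (N' \<inter> period_cell M k)) = emeasure \<mu>' (N' \<inter> period_cell M k)"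
        by (intro emeasure_cell[symmetric] borel_sets_reflected *) auto
      also have "\<dots> \<le> emeasure \<mu>' N'"
        using N' by (intro emeasure_mono) auto
      finally have "fold_map M k ` (N' \<inter> period_cell M k) \<in> null_sets \<nu>0"
        using N'(3) fold_map_image_borel[OF *, of M k] \<nu>0 by (auto simp: null_sets_def)
      then show ?thesis
        unfolding \<nu>0(2) using N(1) by (intro sets_completionI_sub) auto
    qed
    then have "N \<in> sets \<mu>'"
      by (simp add: sets_reflected_measure[OF \<mu>] reflected_sets_def)
    then show ?thesis
      using N N' by (intro null_sets_subset[of N' \<mu>' N]) (auto simp: null_sets_def)
  qed
  show "\<mu>' = completion \<nu>"
  proof (rule measure_eqI)
    show "sets \<mu>' = sets (completion \<nu>)"
    proof
      show "sets (completion \<nu>) \<subseteq> sets \<mu>'"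
      proof
        fix A assume "A \<in> sets (completion \<nu>)"
        then obtain S N N' where "A = S \<union> N" "N \<subseteq> N'" "N' \<in> null_sets \<nu>" "S \<in> sets \<nu>"
          by (rule sets_completionE)
        then show "A \<in> sets \<mu>'"
          using null_sub[of N N'] borel_sets_reflected[of S] sets_\<nu> by auto
      qed
    qed (use sub1 in blast)
    fix A assume "A \<in> sets \<mu>'"
    then have "A \<in> sets (completion \<nu>)"
      by (rule sub1)
    then obtain S N N' where A: "A = S \<union> N" "N \<subseteq> N'" "N' \<in> null_sets \<nu>" "S \<in> sets \<nu>"
      by (rule sets_completionE)
    have "emeasure \<mu>' A = emeasure \<mu>' S"
      unfolding A(1) using null_sub[OF A(2,3)] A(4) borel_sets_reflected[of S] sets_\<nu>
      by (intro emeasure_Un_null_set) auto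
    also have "\<dots> = emeasure (completion \<nu>) S"
      using A(4) sets_\<nu> \<nu> by simp
    also have "\<dots> = emeasure (completion \<nu>) A"
      unfolding A(1) using A by (intro emeasure_Un_null_set[symmetric])
        (auto intro: null_sets_completion_subset null_sets_completionI)
    finally show "emeasure \<mu>' A = emeasure (completion \<nu>) A" .
  qed
qed

lemma uniform_small_scale_reflected:
  assumes "1 \<le> p" "1 < \<theta>" "admissible_within p \<mu> (ball 0 (\<theta> * M))"
  shows "\<exists>R D K c C. uniform_small_scale \<mu>' p R D K c C"
proof -
  obtain D C \<Lambda> where D: "doubling_within_with D \<mu> (ball 0 (\<theta> * M))" "0 < D"
    and P: "poincare_within_with p C \<Lambda> \<mu> (ball 0 (\<theta> * M))" "0 < C" "1 \<le> \<Lambda>"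
    using assms(3) unfolding admissible_within_def doubling_within_def poincare_within_def by blast
  \<comment> \<open>\<open>2 * R <= M\<close> keeps even a doubled ball within three cells, and
    \<open>M + 6 * R <= \<theta> * M\<close> leaves the room that the Muckenhoupt estimate needs
    around a folded centre.\<close>
  define R where "R = min (M / 2) ((\<theta> - 1) * M / 6)"
  have R: "0 < R" "2 * R \<le> M" "M + 6 * R \<le> \<theta> * M"
    using M assms(2) by (auto simp: R_def min_def field_simps)
  \<comment> \<open>The radius is R/8 because the folded part of a ball of radius R/4 is only sure
    to contain a ball of half that radius.\<close>
  obtain c where c: "0 < c" "\<And>z. \<bar>z\<bar> \<le> M \<Longrightarrow> ennreal c \<le> emeasure \<mu> (ball z (R / 8))"
    using emeasure_ball_bounded_below[OF \<mu>, of "R / 8" M] R by auto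
  \<comment> \<open>The factor 3 counts cells, and the maximum with c secures c <= C'.\<close>
  define C' where "C' = max c (3 * measure \<mu> (ball 0 (M + R)))"
  have small: "uniform_small_scale \<mu>' p R (3 * D ^ 3) (9 * (3 * C * D ^ 3)) c C'"
  proof
    fix x r :: real
    obtain k where k: "x \<in> period_cell M k"
      by (rule cell_exists)
    define y where "y = fold_map M k x"
    have y: "\<bar>y\<bar> \<le> M"
      using abs_fold_map_le[OF k] by (simp add: y_def)
    show "ennreal c \<le> emeasure \<mu>' (ball x (R / 4))"
    proof -
      obtain z where "\<bar>z\<bar> \<le> M" "\<bar>z - fold_map M k x\<bar> = R / 4 / 2"
        "ball z (R / 4 / 2) \<subseteq> fold_map M k ` (ball x (R / 4) \<inter> period_cell M k)"
        by (rule ball_subset_fold_map_ball_exists[OF k, of "R / 4"]) (use R in auto)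
      then show ?thesis
        using c(2)[of z] emeasure_ball_ge[of z "R / 8" k x "R / 4"] by simp
    qed
    show "emeasure \<mu>' (ball x R) \<le> ennreal C'"
    proof -
      have "emeasure \<mu>' (ball x R) \<le> 3 * emeasure \<mu> (ball y R)"
        unfolding y_def using R by (intro emeasure_ball_le k) auto
      also have "\<dots> \<le> 3 * emeasure \<mu> (ball 0 (M + R))"
        using y by (intro mult_left_mono emeasure_mono measure_on_R_borel_sets[OF \<mu>])
          (auto simp: dist_real_def)
      also have "\<dots> = ennreal (3 * measure \<mu> (ball 0 (M + R)))"
        using measure_on_R_ball[OF \<mu>, of "M + R" 0] R M
        by (simp add: emeasure_eq_ennreal_measure ennreal_mult)
      also have "\<dots> \<le> ennreal C'"
        by (intro ennreal_leI) (simp add: C'_def)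
      finally show ?thesis .
    qed
    assume r: "0 < r" "r \<le> R"
    show "emeasure \<mu>' (ball x (2 * r)) \<le> ennreal (3 * D ^ 3) * emeasure \<mu>' (ball x r)"
    proof -
      obtain z where z: "\<bar>z\<bar> \<le> M" "\<bar>z - y\<bar> = r / 2"
        "ball z (r / 2) \<subseteq> fold_map M k ` (ball x r \<inter> period_cell M k)"
        using ball_subset_fold_map_ball_exists[OF k, of r] r R by (auto simp: y_def)
      \<comment> \<open>The distance is below r/2 + 2r, which is less than 4r = 2^3 (r/2), so three
        doublings suffice.\<close>
      have "t \<in> ball z (2 ^ 3 * (r / 2))" if "t \<in> ball y (2 * r)" for t
        using that z(2) r(1) dist_triangle[of z t y] by (simp add: dist_real_def)
      then have sub: "ball y (2 * r) \<subseteq> ball z (2 ^ 3 * (r / 2))"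
        by blast
      have "emeasure \<mu>' (ball x (2 * r)) \<le> 3 * emeasure \<mu> (ball y (2 * r))"
        unfolding y_def using R r by (intro emeasure_ball_le k) auto
      also have "\<dots> \<le> 3 * emeasure \<mu> (ball z (2 ^ 3 * (r / 2)))"
        by (intro mult_left_mono emeasure_mono measure_on_R_borel_sets[OF \<mu>] sub) auto
      also have "\<dots> \<le> 3 * (ennreal D ^ 3 * emeasure \<mu> (ball z (r / 2)))"
        using z(1) r R by (intro mult_left_mono doubling_within_iterate[OF D(1)])
          (auto simp: dist_real_def)
      also have "\<dots> \<le> 3 * (ennreal D ^ 3 * emeasure \<mu>' (ball x r))"
        by (intro mult_left_mono emeasure_ball_ge[OF z(3)]) auto
      also have "\<dots> = ennreal (3 * D ^ 3) * emeasure \<mu>' (ball x r)"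
        using D by (simp add: ennreal_mult ennreal_power mult.assoc)
      finally show ?thesis .
    qed
    show "muckenhoupt_ball p (9 * (3 * C * D ^ 3)) \<mu>' x r"
    proof (rule muckenhoupt_ball_reflected[OF assms(1) _ r(1) _ k])
      show "muckenhoupt_ball p (3 * C * D ^ 3) \<mu> (fold_map M k x) r"
        using y r R by (intro muckenhoupt_ball_of_poincare[OF \<mu> assms(1) D P]) (auto simp: y_def)
    qed (use r R P D in auto)
  qed (use R D P c assms(1) in \<open>auto simp: C'_def borel_sets_reflected space_reflected\<close>)
  then show ?thesis
    by blast
qed

end

theorem mainTheorem5:
  fixes p M \<theta> :: real and \<mu> :: "real measure"
  assumes "1 \<le> p" and "M > 0"
    and "measure_on_R \<mu>"
    and "\<theta> > 1" and "admissible_within p \<mu> (ball 0 (\<theta> * M))"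
  shows "measure_on_R (reflected_measure M \<mu>) \<and> globally_admissible p (reflected_measure M \<mu>)"
proof -
  interpret reflection \<mu> M
    using assms by unfold_locales
  obtain R D K c C where "uniform_small_scale (reflected_measure M \<mu>) p R D K c C"
    using uniform_small_scale_reflected assms by blast
  then interpret uniform_small_scale "reflected_measure M \<mu>" p R D K c C .
  show ?thesis
    using reflected_completion ball_pos_finite globally_admissible unfolding measure_on_R_def by blast
qed

end
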